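(* Let $m_1,m_2,n_1,n_2,l,k$ be positive integers. Let $L$ be the invertible linear transform $L(\mathcal{A})=\mathcal{A}\times_3\mathbf{L}$ associated with an invertible matrix $\mathbf{L}\in\mathbb{C}^{l\times l}$ (with $L$ mapping real tensors to real tensors), and suppose that for some constant $\rho>0$ one has $\mathbf{L}^{\mathrm H}\mathbf{L}=\mathbf{L}\mathbf{L}^{\mathrm H}=\rho\,\mathbf{I}_l$ and $\mathbf{L}^{-1}=\mathbf{L}^{\mathrm H}/\rho$. Let $\mathcal{A}\in\mathbb{R}^{m_1m_2\times n_1n_2\times l}$. Then $\mathcal{A}$ can be factorized as $$\mathcal{A}=\sum_{i=1}^{k}\mathcal{U}_i\ltimes_L\mathcal{S}_i\ltimes_L\mathcal{V}_i^\top+\mathcal{E}_k,$$ where $\mathcal{U}_i\in\mathbb{R}^{m_1\times m_1\times l}$ and $\mathcal{V}_i\in\mathbb{R}^{n_1\times n_1\times l}$ ($i=1,\dots,k$) are orthogonal tensors, each frontal slice of $\mathcal{S}_i\in\mathbb{R}^{m_1m_2\times n_1n_2\times l}$ is a block-diagonal matrix (with blocks of size $m_2\times n_2$), and the error tensor $\mathcal{E}_k$ satisfies $$\|\mathcal{E}_k\|_F^2=\frac1\rho\sum_{j=1}^{l}\sum_{i=k+1}^{v}\bigl(\hat\sigma_i^{(j)}\bigr)^2,$$ where $\hat\sigma_1^{(j)}\ge\hat\sigma_2^{(j)}\ge\dots\ge\hat\sigma_v^{(j)}\ge 0$ are the singular values of $\mathscr{R}(\bar{\mathcal{A}}^{(j)})\in\mathbb{R}^{m_1n_1\times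 m_2n_2}$, $\bar{\mathcal{A}}=L(\mathcal{A})$, and $v=\min\{m_1n_1,m_2n_2\}$.
   Context: Tensors. For a third-order tensor $\mathcal{A}$ with third dimension $l$, $\mathcal{A}^{(j)}$ denotes its $j$-th frontal slice (the matrix with entries $\mathcal{A}_{abj}$), and $\|\mathcal{A}\|_F=(\sum_{a,b,j}|\mathcal{A}_{abj}|^2)^{1/2}$. Transform. Given an invertible matrix $\mathbf{L}\in\mathbb{C}^{l\times l}$, the linear transform $L:\mathbb{R}^{p\times q\times l}\to\mathbb{R}^{p\times q\times l}$ (for all $p,q$) is the mode-3 product $\bar{\mathcal{A}}=L(\mathcal{A})=\mathcal{A}\times_3\mathbf{L}$, i.e. $\bar{\mathcal{A}}_{abj}=\sum_{j'}\mathbf{L}_{jj'}\mathcal{A}_{abj'}$; its inverse is $L^{-1}(\bar{\mathcal{A}})=\bar{\mathcal{A}}\times_3\mathbf{L}^{-1}$. t-product. $\mathrm{bdiag}(\bar{\mathcal{A}})$ is the block-diagonal matrix with diagonal blocks $\bar{\mathcal{A}}^{(1)},\dots,\bar{\mathcal{A}}^{(l)}$, and $\mathrm{fold}$ is the inverse operation, $\mathrm{fold}(\mathrm{bdiag}(\bar{\mathcal{A}}))=\bar{\mathcal{A}}$. For $\mathcal{A}\in\mathbb{R}^{p\times q\times l}$, $\mathcal{B}\in\mathbb{R}^{q\times r\times l}$, $\mathcal{A}*_L\mathcal{B}=L^{-1}[\mathrm{fold}(\mathrm{bdiag}(\bar{\mathcal{A}})\,\mathrm{bdiag}(\bar{\mathcal{B}}))]\in\mathbb{R}^{p\times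 r\times l}$. The transpose $\mathcal{A}^\top$ under $L$ is the tensor with $L(\mathcal{A}^\top)^{(j)}=(L(\mathcal{A})^{(j)})^\top$ for all $j$. The identity tensor $\mathcal{I}\in\mathbb{R}^{n\times n\times l}$ under $L$ is the tensor such that every frontal slice of $L(\mathcal{I})$ is $\mathbf{I}_n$. A tensor $\mathcal{Q}\in\mathbb{R}^{n\times n\times l}$ is orthogonal if $\mathcal{Q}^\top*_L\mathcal{Q}=\mathcal{Q}*_L\mathcal{Q}^\top=\mathcal{I}$. Semi-tensor product of tensors. For $\mathcal{A}\in\mathbb{R}^{p\times q\times l}$, $\mathcal{B}\in\mathbb{R}^{r\times s\times l}$ and $t=\mathrm{lcm}(q,r)$, $$\mathcal{A}\ltimes_L\mathcal{B}=(\mathcal{A}\otimes\mathcal{I}_{t/q})*_L(\mathcal{B}\otimes\mathcal{I}_{t/r})\in\mathbb{R}^{p(t/q)\times s(t/r)\times l},$$ where $\mathcal{I}_c\in\mathbb{R}^{c\times c\times1}$ is the tensor whose only frontal slice is $\mathbf{I}_c$ and $\mathcal{A}\otimes\mathcal{I}_c$ is the tensor with frontal slices $\mathcal{A}^{(j)}\otimes\mathbf{I}_c$ (matrix Kronecker product). Block-diagonal. An $m_1m_2\times n_1n_2$ matrix, viewed as an $m_1\times n_1$ array of $m_2\times n_2$ blocks, is block-diagonal if its $(a,b)$ block is zero whenever $a\neq b$. Rearrangement operator. For $\mathbf{A}\in\mathbb{R}^{m_1m_2\times n_1n_2}$ partitioned into blocks $\mathbf{A}_{a,b}\in\mathbb{R}^{m_2\times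 n_2}$ ($1\le a\le m_1$, $1\le b\le n_1$), put $\mathbf{A}_b=[\mathrm{vec}(\mathbf{A}_{1,b}),\dots,\mathrm{vec}(\mathbf{A}_{m_1,b})]^\top\in\mathbb{R}^{m_1\times m_2n_2}$ ($\mathrm{vec}$ stacks columns); $\mathscr{R}(\mathbf{A})\in\mathbb{R}^{m_1n_1\times m_2n_2}$ is the matrix obtained by stacking $\mathbf{A}_1,\mathbf{A}_2,\dots,\mathbf{A}_{n_1}$ vertically. Empty sums are zero. *)

theory Defs
  imports
    "Jordan_Normal_Form.Gauss_Jordan_Elimination"
    "Jordan_Normal_Form.Schur_Decomposition"
begin

text \<open>
  A tensor of size \<open>p \<times> q \<times> l\<close> is the list of its \<open>l\<close> frontal slices. The entries have type
  \<^typ>\<open>complex\<close> because the transform has a complex matrix; real tensors form a subset.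
  All indices start at 0. The sizes \<open>p\<close> and \<open>q\<close> are read off the first slice, so the
  definitions below are meaningful for \<open>l > 0\<close> only.
\<close>

type_synonym tensor = "complex mat list"

definition tensors :: "nat \<Rightarrow> nat \<Rightarrow> nat \<Rightarrow> tensor set" where
  "tensors p q l = {A. length A = l \<and> set A \<subseteq> carrier_mat p q}"

definition real_tensors :: "nat \<Rightarrow> nat \<Rightarrow> nat \<Rightarrow> tensor set" where
  "real_tensors p q l = {A \<in> tensors p q l. \<forall>X\<in>set A. elements_mat X \<subseteq> \<real>}"

abbreviation tdim_row :: "tensor \<Rightarrow> nat" where
  "tdim_row A \<equiv> dim_row (hd A)"

abbreviation tdim_col :: "tensor \<Rightarrow> nat" where
  "tdim_col A \<equiv> dim_col (hd A)"

definition tensor_add :: "tensor \<Rightarrow> tensor \<Rightarrow> tensor" where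
  "tensor_add A B = map2 (+) A B"

definition tensor_sum :: "nat \<Rightarrow> nat \<Rightarrow> nat \<Rightarrow> (nat \<Rightarrow> tensor) \<Rightarrow> nat set \<Rightarrow> tensor" where
  "tensor_sum p q l T I =
     map (\<lambda>j. mat p q (\<lambda>(a, b). \<Sum>i\<in>I. (T i ! j) $$ (a, b))) [0..<l]"

definition tensor_norm :: "tensor \<Rightarrow> real" where
  "tensor_norm A =
     sqrt (\<Sum>a<tdim_row A. \<Sum>b<tdim_col A. \<Sum>j<length A. (cmod ((A ! j) $$ (a, b)))\<^sup>2)"

abbreviation mat_inv :: "complex mat \<Rightarrow> complex mat" where
  "mat_inv M \<equiv> the (mat_inverse M)"

text \<open>The mode-3 product with \<open>M\<close>; the inverse transform is \<open>mode3 (mat_inv M)\<close>.\<close>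

definition mode3 :: "complex mat \<Rightarrow> tensor \<Rightarrow> tensor" where
  "mode3 M A =
     map (\<lambda>j. mat (tdim_row A) (tdim_col A)
            (\<lambda>(a, b). \<Sum>j'<dim_col M. M $$ (j, j') * (A ! j') $$ (a, b)))
       [0..<dim_row M]"

text \<open>\<open>mat_block p q X a b\<close> is the block \<open>(a, b)\<close> of \<open>X\<close> partitioned into \<open>p \<times> q\<close> blocks.\<close>

definition mat_block :: "nat \<Rightarrow> nat \<Rightarrow> complex mat \<Rightarrow> nat \<Rightarrow> nat \<Rightarrow> complex mat" where
  "mat_block p q X a b = mat p q (\<lambda>(r, c). X $$ (a * p + r, b * q + c))"

text \<open>
  \<open>bdiag\<close> is \<^const>\<open>diag_block_mat\<close>, and \<open>tensor_fold\<close> collects its \<open>p \<times> q\<close> diagonal blocks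
  (see \<open>tensor_fold_diag_block_mat\<close>).
\<close>

definition tensor_fold :: "nat \<Rightarrow> nat \<Rightarrow> nat \<Rightarrow> complex mat \<Rightarrow> tensor" where
  "tensor_fold p q l X = map (\<lambda>j. mat_block p q X j j) [0..<l]"

definition t_prod :: "complex mat \<Rightarrow> tensor \<Rightarrow> tensor \<Rightarrow> tensor" where
  "t_prod M A B =
     mode3 (mat_inv M)
       (tensor_fold (tdim_row A) (tdim_col B) (length A)
          (diag_block_mat (mode3 M A) * diag_block_mat (mode3 M B)))"

text \<open>
  The transpose and the identity are the unique tensors with the prescribed transform.
\<close>

definition t_transpose :: "complex mat \<Rightarrow> tensor \<Rightarrow> tensor" where
  "t_transpose M A =
     (THE B. B \<in> tensors (tdim_col A) (tdim_row A) (length A) \<and>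
        (\<forall>j<length A. mode3 M B ! j = transpose_mat (mode3 M A ! j)))"

definition t_identity :: "complex mat \<Rightarrow> nat \<Rightarrow> tensor" where
  "t_identity M n =
     (THE B. B \<in> tensors n n (dim_row M) \<and> (\<forall>j<dim_row M. mode3 M B ! j = 1\<^sub>m n))"

definition t_orthogonal :: "complex mat \<Rightarrow> nat \<Rightarrow> nat \<Rightarrow> tensor \<Rightarrow> bool" where
  "t_orthogonal M n l Q \<longleftrightarrow>
     Q \<in> real_tensors n n l \<and>
     t_prod M (t_transpose M Q) Q = t_identity M n \<and>
     t_prod M Q (t_transpose M Q) = t_identity M n"

definition kron :: "complex mat \<Rightarrow> complex mat \<Rightarrow> complex mat" where
  "kron X Y =
     mat (dim_row X * dim_row Y) (dim_col X * dim_col Y)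
       (\<lambda>(i, j). X $$ (i div dim_row Y, j div dim_col Y) * Y $$ (i mod dim_row Y, j mod dim_col Y))"

definition tensor_kron_id :: "tensor \<Rightarrow> nat \<Rightarrow> tensor" where
  "tensor_kron_id A c = map (\<lambda>X. kron X (1\<^sub>m c)) A"

definition semi_tensor_prod :: "complex mat \<Rightarrow> tensor \<Rightarrow> tensor \<Rightarrow> tensor" where
  "semi_tensor_prod M A B =
     (let q = tdim_col A; r = tdim_row B; t = lcm q r
      in t_prod M (tensor_kron_id A (t div q)) (tensor_kron_id B (t div r)))"

definition block_diagonal :: "nat \<Rightarrow> nat \<Rightarrow> nat \<Rightarrow> nat \<Rightarrow> complex mat \<Rightarrow> bool" where
  "block_diagonal m1 m2 n1 n2 X \<longleftrightarrow>
     X \<in> carrier_mat (m1 * m2) (n1 * n2) \<and>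
     (\<forall>a<m1. \<forall>b<n1. a \<noteq> b \<longrightarrow> mat_block m2 n2 X a b = 0\<^sub>m m2 n2)"

definition vec_cols :: "complex mat \<Rightarrow> complex vec" where
  "vec_cols X =
     vec (dim_row X * dim_col X) (\<lambda>i. X $$ (i mod dim_row X, i div dim_row X))"

definition rearrange :: "nat \<Rightarrow> nat \<Rightarrow> nat \<Rightarrow> nat \<Rightarrow> complex mat \<Rightarrow> complex mat" where
  "rearrange m1 m2 n1 n2 X =
     mat_of_rows (m2 * n2)
       (concat (map (\<lambda>b. map (\<lambda>a. vec_cols (mat_block m2 n2 X a b)) [0..<m1]) [0..<n1]))"

text \<open>
  The \<open>min m n\<close> singular values of an \<open>m \<times> n\<close> matrix, in decreasing order: the square roots of
  the \<open>n\<close> eigenvalues (with algebraic multiplicity) of the Gram matrix. If \<open>n > m\<close>, the last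
  \<open>n - m\<close> of these roots are zeros that do not count as singular values. The eigenvalues are
  nonnegative reals, so \<^const>\<open>Re\<close> loses nothing.
\<close>

definition singular_values :: "complex mat \<Rightarrow> real list" where
  "singular_values X =
     take (min (dim_row X) (dim_col X))
       (rev (sorted_list_of_multiset
          (image_mset (\<lambda>z. sqrt (Re z)) (proots (char_poly (mat_adjoint X * X))))))"

lemma tensors_nth: "A \<in> tensors p q l \<Longrightarrow> j < l \<Longrightarrow> A ! j \<in> carrier_mat p q"
  by (auto simp: tensors_def)

lemma tensors_dims:
  assumes "A \<in> tensors p q l" "0 < l"
  shows "tdim_row A = p" "tdim_col A = q"
  using assms by (cases A; auto simp: tensors_def)+

lemma tensor_eqI:
  assumes "A \<in> tensors p q l" "B \<in> tensors p q l"
    and "\<And>j a b. j < l \<Longrightarrow> a < p \<Longrightarrow> b < q \<Longrightarrow> (A ! j) $$ (a, b) = (B ! j) $$ (a, b)"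
  shows "A = B"
proof (rule nth_equalityI)
  show "length A = length B" using assms by (simp add: tensors_def)
  fix j assume "j < length A"
  then have j: "j < l" using assms by (simp add: tensors_def)
  show "A ! j = B ! j"
    using tensors_nth[OF assms(1) j] tensors_nth[OF assms(2) j] assms(3)[OF j]
    by (intro eq_matI) auto
qed

lemma mode3_in_tensors:
  assumes "A \<in> tensors p q l" "0 < l"
  shows "mode3 M A \<in> tensors p q (dim_row M)"
  using tensors_dims[OF assms] by (auto simp: tensors_def mode3_def)

lemma mode3_index:
  assumes "A \<in> tensors p q l" "0 < l" "j < dim_row M" "a < p" "b < q"
  shows "(mode3 M A ! j) $$ (a, b) = (\<Sum>j'<dim_col M. M $$ (j, j') * (A ! j') $$ (a, b))"
  using tensors_dims[OF assms(1,2)] assms(3-) by (simp add: mode3_def)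

lemma mode3_mode3:
  assumes A: "A \<in> tensors p q l" and l: "0 < l"
    and M: "M \<in> carrier_mat l l" and N: "N \<in> carrier_mat l l" and NM: "N * M = 1\<^sub>m l"
  shows "mode3 N (mode3 M A) = A"
proof (rule tensor_eqI)
  have MA: "mode3 M A \<in> tensors p q l"
    using mode3_in_tensors[OF A l, of M] M by simp
  then show "mode3 N (mode3 M A) \<in> tensors p q l"
    using mode3_in_tensors[OF MA l, of N] N by simp
  fix j a b assume j: "j < l" and a: "a < p" and b: "b < q"
  have "(mode3 N (mode3 M A) ! j) $$ (a, b)
      = (\<Sum>i<l. N $$ (j, i) * (\<Sum>j'<l. M $$ (i, j') * (A ! j') $$ (a, b)))"
    using mode3_index[OF MA l _ a b, of j N] mode3_index[OF A l _ a b, of _ M] M N j by simp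
  also have "\<dots> = (\<Sum>j'<l. (\<Sum>i<l. N $$ (j, i) * M $$ (i, j')) * (A ! j') $$ (a, b))"
    unfolding sum_distrib_left sum_distrib_right by (subst sum.swap) (simp add: mult.assoc)
  also have "\<dots> = (\<Sum>j'<l. (N * M) $$ (j, j') * (A ! j') $$ (a, b))"
    using M N j by (intro sum.cong) (auto simp: scalar_prod_def lessThan_atLeast0)
  also have "\<dots> = (\<Sum>j'<l. if j' = j then (A ! j') $$ (a, b) else 0)"
    using j by (intro sum.cong) (auto simp: NM)
  also have "\<dots> = (A ! j) $$ (a, b)"
    using j by simp
  finally show "(mode3 N (mode3 M A) ! j) $$ (a, b) = (A ! j) $$ (a, b)" .
qed (rule A)

lemma mat_inv:
  assumes "M \<in> carrier_mat l l" "invertible_mat M"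
  shows "mat_inv M \<in> carrier_mat l l" "mat_inv M * M = 1\<^sub>m l" "M * mat_inv M = 1\<^sub>m l"
proof -
  obtain B where B: "inverts_mat M B" "inverts_mat B M"
    using assms by (auto simp: invertible_mat_def)
  have "B \<in> carrier_mat l l"
    using assms B unfolding inverts_mat_def
    by (metis carrier_matD carrier_matI index_mult_mat(2,3) index_one_mat(2,3))
  then have "M \<in> Units (ring_mat TYPE(complex) l ())"
    using assms B by (auto simp: Units_def ring_mat_def inverts_mat_def)
  then obtain C where "mat_inverse M = Some C"
    using mat_inverse(1)[OF assms(1), of "()"] by blast
  then show "mat_inv M \<in> carrier_mat l l" "mat_inv M * M = 1\<^sub>m l" "M * mat_inv M = 1\<^sub>m l"
    using mat_inverse(2)[OF assms(1)] by auto
qed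

lemma ex1_tensor_with_transform:
  assumes M: "M \<in> carrier_mat l l" "invertible_mat M" and l: "0 < l"
    and C: "\<And>j. j < l \<Longrightarrow> C j \<in> carrier_mat p q"
  shows "\<exists>!B. B \<in> tensors p q l \<and> (\<forall>j<l. mode3 M B ! j = C j)"
proof (rule ex1I)
  let ?C = "map C [0..<l]"
  have C': "?C \<in> tensors p q l" using C by (auto simp: tensors_def)
  have "mode3 M (mode3 (mat_inv M) ?C) = ?C"
    by (rule mode3_mode3[OF C' l]) (use mat_inv[OF M] M in auto)
  then show "mode3 (mat_inv M) ?C \<in> tensors p q l \<and>
      (\<forall>j<l. mode3 M (mode3 (mat_inv M) ?C) ! j = C j)"
    using mode3_in_tensors[OF C' l, of "mat_inv M"] mat_inv(1)[OF M] by auto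
  fix B assume B: "B \<in> tensors p q l \<and> (\<forall>j<l. mode3 M B ! j = C j)"
  have "mode3 M B = ?C"
    using B M by (intro nth_equalityI) (auto simp: mode3_def)
  moreover have "mode3 (mat_inv M) (mode3 M B) = B"
    using B by (intro mode3_mode3[OF _ l]) (use mat_inv[OF M] M in auto)
  ultimately show "B = mode3 (mat_inv M) ?C" by simp
qed

lemma t_transpose_transform:
  assumes M: "M \<in> carrier_mat l l" "invertible_mat M" and l: "0 < l" and A: "A \<in> tensors p q l"
  shows "t_transpose M A \<in> tensors q p l"
    and "j < l \<Longrightarrow> mode3 M (t_transpose M A) ! j = transpose_mat (mode3 M A ! j)"
proof -
  have len: "length A = l" using A by (simp add: tensors_def)
  have "mode3 M A \<in> tensors p q l"
    using mode3_in_tensors[OF A l, of M] M by simp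
  then have "\<exists>!B. B \<in> tensors q p l \<and> (\<forall>j<l. mode3 M B ! j = transpose_mat (mode3 M A ! j))"
    by (intro ex1_tensor_with_transform[OF M l] transpose_carrier_mat[THEN iffD2] tensors_nth)
  from theI'[OF this] show "t_transpose M A \<in> tensors q p l"
    and "j < l \<Longrightarrow> mode3 M (t_transpose M A) ! j = transpose_mat (mode3 M A ! j)"
    unfolding t_transpose_def tensors_dims[OF A l] len by auto
qed

lemma t_identity_transform:
  assumes M: "M \<in> carrier_mat l l" "invertible_mat M" and l: "0 < l"
  shows "t_identity M n \<in> tensors n n l"
    and "j < l \<Longrightarrow> mode3 M (t_identity M n) ! j = 1\<^sub>m n"
proof -
  have len: "dim_row M = l" using M by simp
  have "\<exists>!B. B \<in> tensors n n l \<and> (\<forall>j<l. mode3 M B ! j = 1\<^sub>m n)"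
    by (intro ex1_tensor_with_transform[OF M l]) auto
  from theI'[OF this] show "t_identity M n \<in> tensors n n l"
    and "j < l \<Longrightarrow> mode3 M (t_identity M n) ! j = 1\<^sub>m n"
    unfolding t_identity_def len by auto
qed

lemma diag_block_mat_block:
  assumes "set A \<subseteq> carrier_mat p q" "j < length A"
  shows "mat_block p q (diag_block_mat A) j j = A ! j"
  using assms
proof (induction A arbitrary: j)
  case (Cons X A)
  have X: "X \<in> carrier_mat p q" using Cons by simp
  have "map dim_row A = replicate (length A) p" "map dim_col A = replicate (length A) q"
    using Cons.prems by (auto intro!: nth_equalityI simp: subset_iff in_set_conv_nth)
       (metis carrier_matD)+
  then have d: "dim_row (diag_block_mat A) = length A * p"
      "dim_col (diag_block_mat A) = length A * q"
    by (simp_all add: dim_diag_block_mat sum_list_replicate)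
  have le: "i * n + r < length A * n" if "i < length A" "r < n" for i r n :: nat
    using that mult_le_mono1[of "Suc i" "length A" n] by simp
  show ?case
  proof (cases j)
    case 0
    then show ?thesis
      using X by (intro eq_matI) (auto simp: mat_block_def Let_def d)
  next
    case (Suc i)
    then have i: "i < length A" using Cons by simp
    have IH: "mat_block p q (diag_block_mat A) i i = A ! i" using Cons i by simp
    have "mat_block p q (diag_block_mat (X # A)) j j = mat_block p q (diag_block_mat A) i i"
      using X Suc le[OF i] by (intro eq_matI) (auto simp: mat_block_def Let_def d)
    then show ?thesis using IH Suc by simp
  qed
qed simp

lemma tensor_fold_diag_block_mat:
  "A \<in> tensors p q l \<Longrightarrow> tensor_fold p q l (diag_block_mat A) = A"
  by (intro nth_equalityI) (auto simp: tensor_fold_def tensors_def diag_block_mat_block)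

end

theory Submission
  imports Defs
begin

text \<open>
  The transform has a real matrix, so in the transformed domain the problem splits into one problem
  per frontal slice. A singular value decomposition \<open>\<Sum>\<^sub>i \<sigma>\<^sub>i u\<^sub>i w\<^sub>i\<^sup>T\<close> of the rearranged slice
  turns the slice into \<open>\<Sum>\<^sub>i B\<^sub>i \<otimes> C\<^sub>i\<close>, where \<open>B\<^sub>i\<close> and \<open>C\<^sub>i\<close> are \<open>u\<^sub>i\<close> and \<open>\<sigma>\<^sub>i w\<^sub>i\<close> reshaped into matrices.
  A second decomposition \<open>B\<^sub>i = P D Q\<^sup>T\<close> gives
  \<open>B\<^sub>i \<otimes> C\<^sub>i = (P \<otimes> I) (D \<otimes> C\<^sub>i) (Q\<^sup>T \<otimes> I)\<close> with a block-diagonal middle factor. The error is the tail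
  of the first decomposition, and the transform scales the Frobenius norm by \<open>\<surd>\<rho>\<close>.
\<close>

section \<open>Kronecker products\<close>

text \<open>Reality is what makes slicewise decompositions fit the tensor notions:
  \<open>t_transpose\<close> transposes without conjugating, and all factors must be real tensors,
  so every slice needs real orthogonal factors. The matrix of the transform is real because it keeps
  unit tensors real; its inverse is real because it is the adjoint divided by \<open>\<rho>\<close>.
  Hence slices of real tensors are real, and real slices lift back to real tensors. The
  rearrangement is the right tool because it permutes entries, so it keeps the Frobenius norm, and
  because it sends B \<otimes> C to the rank-one matrix vec(B) vec(C)^T: sums of Kronecker products
  become sums of rank-one matrices. The factor B_i so obtained is an arbitrary m1 x n1 matrix, which
  is why a second decomposition is needed to reach orthogonal outer factors. Singular values are
  defined through the roots of a characteristic polynomial. An orthonormal eigenbasis of the Gram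
  matrix is therefore not enough: its list of eigenvalues must also be matched with those roots,
  with multiplicity and in order. Finally k may exceed v. The surplus summands are then zero, but
  their outer factors are still orthogonal.\<close>

lemma elements_mat_subset:
  "X \<in> carrier_mat p q \<Longrightarrow> elements_mat X \<subseteq> S \<longleftrightarrow> (\<forall>i<p. \<forall>j<q. X $$ (i, j) \<in> S)"
  by (auto simp: elements_mat_def UN_subset_iff image_subset_iff)

lemma sum_lessThan_mult: "(\<Sum>k<n * m. f k) = (\<Sum>i<n. \<Sum>j<m. f (i * m + j))"
  for f :: "nat \<Rightarrow> 'a::comm_monoid_add"
proof -
  have "(\<Sum>k<n * m. f k) = (\<Sum>i<n. sum f {i * m..<i * m + m})"
    by (rule sum.nat_group[symmetric])
  also have "\<dots> = (\<Sum>i<n. \<Sum>j<m. f (i * m + j))"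
    by (subst sum.atLeastLessThan_shift_0) (simp add: lessThan_atLeast0)
  finally show ?thesis .
qed

lemma mult_add_less: "i < n \<Longrightarrow> r < m \<Longrightarrow> i * m + r < n * m" for i n r m :: nat
  using mult_le_mono1[of "Suc i" n m] by simp

lemma kron_carrier: "X \<in> carrier_mat p q \<Longrightarrow> Y \<in> carrier_mat r s \<Longrightarrow> kron X Y \<in> carrier_mat (p * r) (q * s)"
  by (simp add: kron_def)

lemma kron_index:
  assumes "X \<in> carrier_mat p q" "Y \<in> carrier_mat r s" "i < p * r" "j < q * s"
  shows "kron X Y $$ (i, j) = X $$ (i div r, j div s) * Y $$ (i mod r, j mod s)"
  using assms by (simp add: kron_def)

text \<open>In both semi-tensor products of the theorem one size divides the other, so one Kronecker
  factor is \<open>1\<^sub>m 1\<close>; this removes it.\<close>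

lemma kron_one_one: "kron X (1\<^sub>m 1) = X"
  by (intro eq_matI) (auto simp: kron_def)

section \<open>Tensors in the transformed domain\<close>

text \<open>Splitting off the first blocks turns both factors into 2 x 2 block matrices with zero
  off-diagonal blocks. The block product is defined because the tails have matching inner
  dimensions.\<close>

lemma diag_block_mat_mult:
  assumes "length As = length Bs" "set As \<subseteq> carrier_mat p q" "set Bs \<subseteq> carrier_mat q r"
  shows "diag_block_mat As * diag_block_mat Bs = diag_block_mat (map2 (*) As Bs)"
  using assms
proof (induction As Bs rule: list_induct2)
  case (Cons X As Y Bs)
  have "dim_col A = q" if "A \<in> set As" for A using Cons.prems that by auto
  moreover have "dim_row B = q" if "B \<in> set Bs" for B using Cons.prems that by auto
  ultimately have "map dim_col As = map dim_row Bs"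
    using Cons.hyps by (intro nth_equalityI) simp_all
  then have dim: "dim_col (diag_block_mat As) = dim_row (diag_block_mat Bs)"
    by (simp add: dim_diag_block_mat)
  have "map dim_row (map2 (*) As Bs) = map dim_row As" "map dim_col (map2 (*) As Bs) = map dim_col Bs"
    using Cons(1) by (auto intro!: nth_equalityI)
  then have "dim_row (diag_block_mat (map2 (*) As Bs)) = dim_row (diag_block_mat As)"
    "dim_col (diag_block_mat (map2 (*) As Bs)) = dim_col (diag_block_mat Bs)"
    unfolding dim_diag_block_mat by simp_all
  moreover define a b c where "a = dim_row (diag_block_mat As)"
    and "b = dim_row (diag_block_mat Bs)" and "c = dim_col (diag_block_mat Bs)"
  ultimately have dims: "dim_row (diag_block_mat (map2 (*) As Bs)) = a"
    "dim_col (diag_block_mat (map2 (*) As Bs)) = c"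
    by simp_all
  have DA: "diag_block_mat As \<in> carrier_mat a b" and DB: "diag_block_mat Bs \<in> carrier_mat b c"
    using dim by (auto simp: a_def b_def c_def)
  have X: "X \<in> carrier_mat p q" and Y: "Y \<in> carrier_mat q r" using Cons by auto
  have IH: "diag_block_mat As * diag_block_mat Bs = diag_block_mat (map2 (*) As Bs)"
    using Cons by simp
  have "diag_block_mat (X # As) * diag_block_mat (Y # Bs)
      = four_block_mat X (0\<^sub>m p b) (0\<^sub>m a q) (diag_block_mat As)
        * four_block_mat Y (0\<^sub>m q c) (0\<^sub>m b r) (diag_block_mat Bs)"
    using X Y DA DB by (simp only: diag_block_mat.simps Let_def carrier_matD)
  also have "\<dots> = four_block_mat (X * Y) (0\<^sub>m p c) (0\<^sub>m a r) (diag_block_mat As * diag_block_mat Bs)"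
    using X Y DA DB
    by (subst mult_four_block_mat[OF X zero_carrier_mat zero_carrier_mat DA Y zero_carrier_mat zero_carrier_mat DB])
      simp
  also have "\<dots> = diag_block_mat (map2 (*) (X # As) (Y # Bs))"
    using X Y dims by (simp add: IH Let_def)
  finally show ?case .
qed simp

section \<open>Reality, block structure and inversion of mode-3 products\<close>

lemma real_tensors_alt:
  "A \<in> real_tensors p q l \<longleftrightarrow> A \<in> tensors p q l \<and> (\<forall>j<l. elements_mat (A ! j) \<subseteq> \<real>)"
  by (auto simp: real_tensors_def tensors_def all_set_conv_all_nth)

lemma mode3_real_tensors:
  assumes A: "A \<in> real_tensors p q l" and l: "0 < l" and N: "N \<in> carrier_mat l l" "elements_mat N \<subseteq> \<real>"
  shows "mode3 N A \<in> real_tensors p q l"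
proof -
  have A': "A \<in> tensors p q l" using A by (simp add: real_tensors_alt)
  have NA: "mode3 N A \<in> tensors p q l" using mode3_in_tensors[OF A' l, of N] N by simp
  have "A ! j $$ (a, b) \<in> \<real>" if "j < l" "a < p" "b < q" for j a b
    using that A elements_mat_subset[OF tensors_nth[OF A'], of j "\<real>"] by (auto simp: real_tensors_alt)
  moreover have "N $$ (i, j) \<in> \<real>" if "i < l" "j < l" for i j
    using that N elements_mat_subset[OF N(1), of "\<real>"] by simp
  ultimately show ?thesis
    using NA mode3_index[OF A' l, of _ N] N(1) unfolding real_tensors_alt
    by (auto simp: elements_mat_subset[OF tensors_nth[OF NA]] intro!: sum_in_Reals Reals_mult)
qed

text \<open>Every slice of a mode-3 product is a linear combination of the given slices, and
  vanishing of off-diagonal blocks is a linear condition. Used with the inverse matrix, it carries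
  block-diagonality of the middle factors back from the transformed domain.\<close>

lemma mode3_block_diagonal:
  assumes A: "A \<in> tensors (m1 * m2) (n1 * n2) l" and l: "0 < l" and N: "N \<in> carrier_mat l l"
    and diag: "\<And>j. j < l \<Longrightarrow> block_diagonal m1 m2 n1 n2 (A ! j)" and j: "j < l"
  shows "block_diagonal m1 m2 n1 n2 (mode3 N A ! j)"
  unfolding block_diagonal_def
proof (intro conjI allI impI)
  have NA: "mode3 N A \<in> tensors (m1 * m2) (n1 * n2) l" using mode3_in_tensors[OF A l, of N] N by simp
  show "mode3 N A ! j \<in> carrier_mat (m1 * m2) (n1 * n2)" by (rule tensors_nth[OF NA j])
  fix a b assume ab: "a < m1" "b < n1" "a \<noteq> b"
  have "mode3 N A ! j $$ (a * m2 + r, b * n2 + c) = 0" if "r < m2" "c < n2" for r c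
  proof -
    have "A ! j' $$ (a * m2 + r, b * n2 + c) = 0" if "j' < l" for j'
    proof -
      have "mat_block m2 n2 (A ! j') a b $$ (r, c) = 0"
        using diag[OF that] ab \<open>r < m2\<close> \<open>c < n2\<close> by (simp add: block_diagonal_def)
      then show ?thesis using \<open>r < m2\<close> \<open>c < n2\<close> by (simp add: mat_block_def)
    qed
    then show ?thesis
      using mode3_index[OF A l, of j N] N j ab that by (simp add: mult_add_less)
  qed
  then show "mat_block m2 n2 (mode3 N A ! j) a b = 0\<^sub>m m2 n2"
    by (intro eq_matI) (auto simp: mat_block_def)
qed

text \<open>The tensor with 1 x 1 slices that is 1 in slice j and 0 elsewhere is mapped to column j
  of \<open>M\<close>.\<close>

lemma mode3_entries_real:
  assumes M: "M \<in> carrier_mat l l" and real: "\<And>X. X \<in> real_tensors 1 1 l \<Longrightarrow> mode3 M X \<in> real_tensors 1 1 l"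
  shows "elements_mat M \<subseteq> \<real>"
proof -
  have "M $$ (i, j) \<in> \<real>" if ij: "i < l" "j < l" for i j
  proof -
    let ?X = "map (\<lambda>j'. mat 1 1 (\<lambda>_. of_bool (j' = j))) [0..<l]"
    have X: "?X \<in> real_tensors 1 1 l" by (auto simp: real_tensors_def tensors_def elements_mat_def)
    then have X': "?X \<in> tensors 1 1 l" by (simp add: real_tensors_alt)
    have "mode3 M ?X ! i $$ (0, 0) = (\<Sum>j'<l. M $$ (i, j') * of_bool (j' = j))"
      using mode3_index[OF X', of i M 0 0] M ij by simp
    also have "\<dots> = M $$ (i, j)" using ij by simp
    finally have "mode3 M ?X ! i $$ (0, 0) = M $$ (i, j)" .
    moreover have MX: "mode3 M ?X \<in> real_tensors 1 1 l" by (rule real[OF X])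
    then have "mode3 M ?X ! i $$ (0, 0) \<in> \<real>"
      using ij elements_mat_subset[OF tensors_nth[of "mode3 M ?X" 1 1 l i], of "\<real>"]
      by (simp add: real_tensors_alt)
    ultimately show ?thesis by simp
  qed
  then show ?thesis using elements_mat_subset[OF M] by simp
qed

lemma mode3_inverse_in_tensors:
  assumes M: "M \<in> carrier_mat l l" "invertible_mat M" and l: "0 < l"
    and C: "\<And>j. j < l \<Longrightarrow> C j \<in> carrier_mat p q"
  shows "mode3 (mat_inv M) (map C [0..<l]) \<in> tensors p q l"
proof -
  have "map C [0..<l] \<in> tensors p q l" using C by (auto simp: tensors_def)
  from mode3_in_tensors[OF this l, of "mat_inv M"] show ?thesis using mat_inv(1)[OF M] by simp
qed

lemma mode3_inverse:
  assumes M: "M \<in> carrier_mat l l" "invertible_mat M" and l: "0 < l"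
    and C: "\<And>j. j < l \<Longrightarrow> C j \<in> carrier_mat p q"
  shows "mode3 M (mode3 (mat_inv M) (map C [0..<l])) = map C [0..<l]"
proof -
  have "map C [0..<l] \<in> tensors p q l" using C by (auto simp: tensors_def)
  then show ?thesis by (rule mode3_mode3[OF _ l]) (use mat_inv[OF M] M in auto)
qed

lemma mode3_inject:
  assumes M: "M \<in> carrier_mat l l" "invertible_mat M" and l: "0 < l"
    and A: "A \<in> tensors p q l" and B: "B \<in> tensors p q l"
    and eq: "\<And>j. j < l \<Longrightarrow> mode3 M A ! j = mode3 M B ! j"
  shows "A = B"
proof -
  have "mode3 M A = mode3 M B"
    using eq M by (intro nth_equalityI) (auto simp: mode3_def)
  then show ?thesis
    using mode3_mode3[OF A l M(1) mat_inv(1,2)[OF M]] mode3_mode3[OF B l M(1) mat_inv(1,2)[OF M]] by metis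
qed

section \<open>The t-product and orthogonality, slice by slice\<close>

lemma mode3_nth_mult_carrier:
  assumes M: "M \<in> carrier_mat l l" and A: "A \<in> tensors p q l" and B: "B \<in> tensors q r l" and j: "j < l"
  shows "mode3 M A ! j * mode3 M B ! j \<in> carrier_mat p r"
proof -
  have "0 < l" using j by simp
  then have "mode3 M A \<in> tensors p q l" "mode3 M B \<in> tensors q r l"
    using mode3_in_tensors[OF A, of M] mode3_in_tensors[OF B, of M] M by auto
  from mult_carrier_mat[OF this[THEN tensors_nth, OF j]] show ?thesis .
qed

text \<open>The product of the two large block-diagonal matrices is again of the form
  \<open>diag_block_mat\<close>, so \<open>tensor_fold\<close> recovers exactly the slice
  products.\<close>

lemma t_prod_eq_mode3:
  assumes M: "M \<in> carrier_mat l l" and l: "0 < l"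
    and A: "A \<in> tensors p q l" and B: "B \<in> tensors q r l"
  shows "t_prod M A B = mode3 (mat_inv M) (map (\<lambda>j. mode3 M A ! j * mode3 M B ! j) [0..<l])"
proof -
  have MA: "mode3 M A \<in> tensors p q l" and MB: "mode3 M B \<in> tensors q r l"
    using mode3_in_tensors[OF A l, of M] mode3_in_tensors[OF B l, of M] M by auto
  let ?C = "\<lambda>j. mode3 M A ! j * mode3 M B ! j"
  have C': "map ?C [0..<l] \<in> tensors p r l"
    using mode3_nth_mult_carrier[OF M A B] by (auto simp: tensors_def)
  have "map2 (*) (mode3 M A) (mode3 M B) = map ?C [0..<l]"
    using MA MB by (intro nth_equalityI) (auto simp: tensors_def)
  then have "diag_block_mat (mode3 M A) * diag_block_mat (mode3 M B) = diag_block_mat (map ?C [0..<l])"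
    using diag_block_mat_mult[of "mode3 M A" "mode3 M B" p q r] MA MB by (simp add: tensors_def)
  then show ?thesis
    using tensors_dims[OF A l] tensors_dims[OF B l] A tensor_fold_diag_block_mat[OF C']
    by (simp add: t_prod_def tensors_def)
qed

lemma t_prod_in_tensors:
  assumes M: "M \<in> carrier_mat l l" "invertible_mat M" and l: "0 < l"
    and A: "A \<in> tensors p q l" and B: "B \<in> tensors q r l"
  shows "t_prod M A B \<in> tensors p r l"
  unfolding t_prod_eq_mode3[OF M(1) l A B]
  by (rule mode3_inverse_in_tensors[OF M l mode3_nth_mult_carrier[OF M(1) A B]])

lemma t_prod_transform:
  assumes M: "M \<in> carrier_mat l l" "invertible_mat M" and l: "0 < l"
    and A: "A \<in> tensors p q l" and B: "B \<in> tensors q r l" and j: "j < l"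
  shows "mode3 M (t_prod M A B) ! j = mode3 M A ! j * mode3 M B ! j"
  unfolding t_prod_eq_mode3[OF M(1) l A B]
  using j by (subst mode3_inverse[OF M l mode3_nth_mult_carrier[OF M(1) A B]]) auto

text \<open>The transpose carries no conjugation, to agree with \<open>t_transpose\<close>. Complex
  matrices with real entries avoid a change of type between the slices and the tensors.\<close>

definition real_orthogonal :: "nat \<Rightarrow> complex mat \<Rightarrow> bool" where
  "real_orthogonal n Q \<longleftrightarrow> Q \<in> carrier_mat n n \<and> elements_mat Q \<subseteq> \<real> \<and>
     transpose_mat Q * Q = 1\<^sub>m n \<and> Q * transpose_mat Q = 1\<^sub>m n"

text \<open>Both orthogonality equations hold after the transform, where they are the slicewise
  ones, and the transform is injective.\<close>

lemma t_orthogonal_transform: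
  assumes M: "M \<in> carrier_mat l l" "invertible_mat M" and l: "0 < l"
    and Q: "Q \<in> real_tensors n n l" and orth: "\<And>j. j < l \<Longrightarrow> real_orthogonal n (mode3 M Q ! j)"
  shows "t_orthogonal M n l Q"
proof -
  have Q': "Q \<in> tensors n n l" using Q by (simp add: real_tensors_alt)
  note T = t_transpose_transform[OF M l Q']
  have "t_prod M (t_transpose M Q) Q = t_identity M n"
    using t_prod_in_tensors[OF M l T(1) Q'] t_prod_transform[OF M l T(1) Q'] t_identity_transform[OF M l] orth T(2)
    by (intro mode3_inject[OF M l]) (auto simp: real_orthogonal_def)
  moreover have "t_prod M Q (t_transpose M Q) = t_identity M n"
    using t_prod_in_tensors[OF M l Q' T(1)] t_prod_transform[OF M l Q' T(1)] t_identity_transform[OF M l] orth T(2)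
    by (intro mode3_inject[OF M l]) (auto simp: real_orthogonal_def)
  ultimately show ?thesis using Q by (simp add: t_orthogonal_def)
qed

section \<open>Semi-tensor products, slice by slice\<close>

lemma tensor_kron_id_in_tensors:
  "A \<in> tensors p q l \<Longrightarrow> tensor_kron_id A c \<in> tensors (p * c) (q * c) l"
  using kron_carrier[OF _ one_carrier_mat[of c], of _ p q]
  by (auto simp: tensors_def tensor_kron_id_def subset_iff simp del: carrier_mat_triv)

text \<open>The transform combines slices entry by entry with coefficients that do not depend on the
  position, and \<open>kron\<close> with a fixed matrix is linear in its first argument; so the two
  commute.\<close>

lemma tensor_kron_id_transform:
  assumes M: "M \<in> carrier_mat l l" and l: "0 < l" and A: "A \<in> tensors p q l"
    and j: "j < l"
  shows "mode3 M (tensor_kron_id A c) ! j = kron (mode3 M A ! j) (1\<^sub>m c)"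
proof -
  note K = tensor_kron_id_in_tensors[OF A, of c]
  have MA: "mode3 M A ! j \<in> carrier_mat p q"
    using tensors_nth mode3_in_tensors[OF A l, of M] M j by auto
  have MK: "mode3 M (tensor_kron_id A c) ! j \<in> carrier_mat (p * c) (q * c)"
    using tensors_nth mode3_in_tensors[OF K l, of M] M j by auto
  show "mode3 M (tensor_kron_id A c) ! j = kron (mode3 M A ! j) (1\<^sub>m c)"
  proof (rule eq_matI)
    fix x y assume "x < dim_row (kron (mode3 M A ! j) (1\<^sub>m c))" "y < dim_col (kron (mode3 M A ! j) (1\<^sub>m c))"
    then have xy: "x < p * c" "y < q * c" using kron_carrier[OF MA one_carrier_mat[of c]] by auto
    then have "x div c < p" "y div c < q" by (auto simp: less_mult_imp_div_less)
    moreover have "(tensor_kron_id A c ! i) $$ (x, y) = A ! i $$ (x div c, y div c) * 1\<^sub>m c $$ (x mod c, y mod c)"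
      if "i < l" for i
      using kron_index[OF tensors_nth[OF A that] one_carrier_mat xy] A that
      by (simp add: tensor_kron_id_def tensors_def)
    ultimately show "mode3 M (tensor_kron_id A c) ! j $$ (x, y) = kron (mode3 M A ! j) (1\<^sub>m c) $$ (x, y)"
      using mode3_index[OF K l _ xy, of j M] mode3_index[OF A l, of j M "x div c" "y div c"] M j
        kron_index[OF MA one_carrier_mat xy]
      by (simp add: sum_distrib_right mult.assoc)
  qed (use MK kron_carrier[OF MA one_carrier_mat[of c]] in auto)
qed

lemma semi_tensor_prod_eq_t_prod:
  assumes "0 < l" "A \<in> tensors p q l" "B \<in> tensors r s l" "lcm q r div q = c" "lcm q r div r = d"
  shows "semi_tensor_prod M A B = t_prod M (tensor_kron_id A c) (tensor_kron_id B d)"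
  using tensors_dims[OF assms(2,1)] tensors_dims[OF assms(3,1)] assms(4,5)
  by (simp add: semi_tensor_prod_def Let_def)

text \<open>Both \<open>q * c\<close> and \<open>r * d\<close> equal \<open>lcm q r\<close>; the row
  size is stated as \<open>q * c\<close> so that it matches the columns of the left factor.\<close>

lemma tensor_kron_id_lcm_in_tensors:
  assumes "B \<in> tensors r s l" "lcm q r div q = c" "lcm q r div r = d"
  shows "tensor_kron_id B d \<in> tensors (q * c) (s * d) l"
proof -
  have "q * c = r * d"
    using dvd_mult_div_cancel[of q "lcm q r"] dvd_mult_div_cancel[of r "lcm q r"] assms(2,3) by simp
  then show ?thesis using tensor_kron_id_in_tensors[OF assms(1)] by simp
qed

lemma semi_tensor_prod_in_tensors:
  assumes M: "M \<in> carrier_mat l l" "invertible_mat M" and l: "0 < l"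
    and A: "A \<in> tensors p q l" and B: "B \<in> tensors r s l"
    and cd: "lcm q r div q = c" "lcm q r div r = d"
  shows "semi_tensor_prod M A B \<in> tensors (p * c) (s * d) l"
  unfolding semi_tensor_prod_eq_t_prod[OF l A B cd]
  by (rule t_prod_in_tensors[OF M l tensor_kron_id_in_tensors[OF A] tensor_kron_id_lcm_in_tensors[OF B cd]])

lemma semi_tensor_prod_transform:
  assumes M: "M \<in> carrier_mat l l" "invertible_mat M" and l: "0 < l"
    and A: "A \<in> tensors p q l" and B: "B \<in> tensors r s l"
    and cd: "lcm q r div q = c" "lcm q r div r = d" and j: "j < l"
  shows "mode3 M (semi_tensor_prod M A B) ! j
    = kron (mode3 M A ! j) (1\<^sub>m c) * kron (mode3 M B ! j) (1\<^sub>m d)"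
  unfolding semi_tensor_prod_eq_t_prod[OF l A B cd]
    t_prod_transform[OF M l tensor_kron_id_in_tensors[OF A] tensor_kron_id_lcm_in_tensors[OF B cd] j]
    tensor_kron_id_transform[OF M(1) l A j] tensor_kron_id_transform[OF M(1) l B j] ..

text \<open>These are the only size pairs that occur: m1 against m1 * m2 for the left product, and
  n1 * n2 against n1 for the right one.\<close>

lemma lcm_factor_div:
  fixes m n :: nat
  assumes "0 < m" "0 < n"
  shows "lcm m (m * n) div m = n \<and> lcm m (m * n) div (m * n) = 1 \<and>
    lcm (m * n) m div (m * n) = 1 \<and> lcm (m * n) m div m = n"
proof -
  have "lcm m (m * n) = m * n" "lcm (m * n) m = m * n"
    by (simp_all only: lcm_proj2_if_dvd lcm_proj1_if_dvd dvd_triv_left normalize_nat_def id_apply)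
  then show ?thesis using assms by simp
qed

lemma semi_tensor_prod_left_in_tensors:
  assumes M: "M \<in> carrier_mat l l" "invertible_mat M" and l: "0 < l" and pos: "0 < m1" "0 < m2"
    and U: "U \<in> tensors m1 m1 l" and S: "S \<in> tensors (m1 * m2) n l"
  shows "semi_tensor_prod M U S \<in> tensors (m1 * m2) n l"
  using semi_tensor_prod_in_tensors[OF M l U S, of m2 1] lcm_factor_div[OF pos] by simp

lemma semi_tensor_prod_factors_in_tensors:
  assumes M: "M \<in> carrier_mat l l" "invertible_mat M" and l: "0 < l" and pos: "0 < m1" "0 < m2" "0 < n1" "0 < n2"
    and U: "U \<in> tensors m1 m1 l" and S: "S \<in> tensors (m1 * m2) (n1 * n2) l" and V: "V \<in> tensors n1 n1 l"
  shows "semi_tensor_prod M (semi_tensor_prod M U S) (t_transpose M V) \<in> tensors (m1 * m2) (n1 * n2) l"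
  using semi_tensor_prod_in_tensors[OF M l semi_tensor_prod_left_in_tensors[OF M l pos(1,2) U S]
      t_transpose_transform(1)[OF M l V], of 1 n2] lcm_factor_div[OF pos(3,4)] by simp

text \<open>The smaller matrix in each product is the one that gets enlarged: \<open>U\<close> by
  the identity of size m2, the transpose of \<open>V\<close> by that of size n2. The middle factor
  is left unchanged.\<close>

lemma semi_tensor_prod_factors:
  assumes M: "M \<in> carrier_mat l l" "invertible_mat M" and l: "0 < l" and pos: "0 < m1" "0 < m2" "0 < n1" "0 < n2"
    and U: "U \<in> tensors m1 m1 l" and S: "S \<in> tensors (m1 * m2) (n1 * n2) l" and V: "V \<in> tensors n1 n1 l"
    and j: "j < l"
  shows "mode3 M (semi_tensor_prod M (semi_tensor_prod M U S) (t_transpose M V)) ! j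
    = kron (mode3 M U ! j) (1\<^sub>m m2) * mode3 M S ! j * kron (transpose_mat (mode3 M V ! j)) (1\<^sub>m n2)"
proof -
  note US = semi_tensor_prod_left_in_tensors[OF M l pos(1,2) U S]
  note T = t_transpose_transform[OF M l V]
  have "mode3 M (semi_tensor_prod M U S) ! j = kron (mode3 M U ! j) (1\<^sub>m m2) * kron (mode3 M S ! j) (1\<^sub>m 1)"
    using lcm_factor_div[OF pos(1,2)] by (intro semi_tensor_prod_transform[OF M l U S _ _ j]) auto
  moreover have "mode3 M (semi_tensor_prod M (semi_tensor_prod M U S) (t_transpose M V)) ! j
      = kron (mode3 M (semi_tensor_prod M U S) ! j) (1\<^sub>m 1) * kron (mode3 M (t_transpose M V) ! j) (1\<^sub>m n2)"
    using lcm_factor_div[OF pos(3,4)] by (intro semi_tensor_prod_transform[OF M l US T(1) _ _ j]) auto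
  ultimately show ?thesis using T(2)[OF j] by (simp only: kron_one_one)
qed

section \<open>Linearity of the transform and its effect on the Frobenius norm\<close>

lemma tensor_sum_add_nth:
  assumes "E \<in> tensors p q l" "j < l"
  shows "tensor_add (tensor_sum p q l T I) E ! j = mat p q (\<lambda>(a, b). \<Sum>i\<in>I. (T i ! j) $$ (a, b)) + E ! j"
  using assms by (simp add: tensor_add_def tensor_sum_def tensors_def)

lemma tensor_sum_add_in_tensors:
  assumes E: "E \<in> tensors p q l"
  shows "tensor_add (tensor_sum p q l T I) E \<in> tensors p q l" (is "?A \<in> _")
proof -
  have "length ?A = l" using E by (simp add: tensor_add_def tensor_sum_def tensors_def)
  moreover have "?A ! j \<in> carrier_mat p q" if "j < l" for j
    using tensor_sum_add_nth[OF E that] tensors_nth[OF E that] by simp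
  ultimately show ?thesis unfolding tensors_def by (auto simp: in_set_conv_nth)
qed

lemma mode3_tensor_sum_add:
  assumes l: "0 < l" and M: "M \<in> carrier_mat l l"
    and T: "\<And>i. i \<in> I \<Longrightarrow> T i \<in> tensors p q l" and E: "E \<in> tensors p q l"
    and j: "j < l" and ab: "a < p" "b < q"
  shows "mode3 M (tensor_add (tensor_sum p q l T I) E) ! j $$ (a, b)
    = (\<Sum>i\<in>I. mode3 M (T i) ! j $$ (a, b)) + mode3 M E ! j $$ (a, b)"
proof -
  let ?A = "tensor_add (tensor_sum p q l T I) E"
  note A = tensor_sum_add_in_tensors[OF E, of T I]
  have "?A ! i $$ (a, b) = (\<Sum>h\<in>I. (T h ! i) $$ (a, b)) + E ! i $$ (a, b)" if "i < l" for i
    using tensor_sum_add_nth[OF E that] tensors_nth[OF E that] ab by simp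
  then have "mode3 M ?A ! j $$ (a, b)
      = (\<Sum>h\<in>I. \<Sum>i<l. M $$ (j, i) * (T h ! i) $$ (a, b)) + (\<Sum>i<l. M $$ (j, i) * E ! i $$ (a, b))"
    using mode3_index[OF A l, of j M] M j ab
    by (simp add: distrib_left sum.distrib sum_distrib_left sum.swap[of _ I])
  also have "\<dots> = (\<Sum>i\<in>I. mode3 M (T i) ! j $$ (a, b)) + mode3 M E ! j $$ (a, b)"
    using mode3_index[OF T l, of _ j M] mode3_index[OF E l, of j M] M j ab by simp
  finally show "mode3 M ?A ! j $$ (a, b)
      = (\<Sum>i\<in>I. mode3 M (T i) ! j $$ (a, b)) + mode3 M E ! j $$ (a, b)" .
qed

text \<open>The columns of \<open>M\<close> are orthogonal with squared length
  \<open>\<rho>\<close>. For each fixed position (a, b), expanding the squared moduli of the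
  transformed tube gives a double sum in which only the diagonal terms survive.\<close>

lemma tensor_norm_transform:
  assumes l: "0 < l" and M: "M \<in> carrier_mat l l" and rho: "0 < \<rho>"
    and unit: "mat_adjoint M * M = complex_of_real \<rho> \<cdot>\<^sub>m 1\<^sub>m l" and E: "E \<in> tensors p q l"
  shows "(tensor_norm E)\<^sup>2 = 1 / \<rho> * (\<Sum>j<l. \<Sum>a<p. \<Sum>b<q. (cmod (mode3 M E ! j $$ (a, b)))\<^sup>2)"
proof -
  have orth: "(\<Sum>j<l. cnj (M $$ (j, h)) * M $$ (j, i)) = of_bool (i = h) * \<rho>" if "i < l" "h < l" for i h
  proof -
    have "(mat_adjoint M * M) $$ (h, i) = (\<Sum>j<l. cnj (M $$ (j, h)) * M $$ (j, i))"
      using M that by (simp add: mat_adjoint_def mat_of_rows_def scalar_prod_def lessThan_atLeast0)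
    moreover have "(mat_adjoint M * M) $$ (h, i) = of_bool (i = h) * \<rho>"
      using that by (simp add: unit)
    ultimately show ?thesis by simp
  qed
  have parseval: "(\<Sum>j<l. (cmod (mode3 M E ! j $$ (a, b)))\<^sup>2) = \<rho> * (\<Sum>j<l. (cmod (E ! j $$ (a, b)))\<^sup>2)"
    if ab: "a < p" "b < q" for a b
  proof -
    let ?e = "\<lambda>j. E ! j $$ (a, b)"
    have "complex_of_real (\<Sum>j<l. (cmod (mode3 M E ! j $$ (a, b)))\<^sup>2)
        = (\<Sum>j<l. (\<Sum>i<l. M $$ (j, i) * ?e i) * cnj (\<Sum>h<l. M $$ (j, h) * ?e h))"
      using mode3_index[OF E l _ ab, of _ M] M by (simp only: of_real_sum complex_norm_square) simp
    also have "\<dots> = (\<Sum>j<l. \<Sum>i<l. \<Sum>h<l. ?e i * cnj (?e h) * (cnj (M $$ (j, h)) * M $$ (j, i)))"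
      by (simp add: sum_product mult_ac)
    also have "\<dots> = (\<Sum>i<l. \<Sum>h<l. \<Sum>j<l. ?e i * cnj (?e h) * (cnj (M $$ (j, h)) * M $$ (j, i)))"
      by (rule trans[OF sum.swap], rule sum.cong[OF refl], rule sum.swap)
    also have "\<dots> = (\<Sum>i<l. \<Sum>h<l. ?e i * cnj (?e h) * (of_bool (i = h) * \<rho>))"
      by (simp add: orth flip: sum_distrib_left)
    also have "\<dots> = (\<Sum>i<l. \<Sum>h<l. if h = i then ?e i * cnj (?e i) * \<rho> else 0)"
      by (intro sum.cong) auto
    also have "\<dots> = (\<Sum>i<l. ?e i * cnj (?e i) * \<rho>)" by simp
    also have "\<dots> = complex_of_real (\<rho> * (\<Sum>j<l. (cmod (?e j))\<^sup>2))"
      by (simp only: of_real_sum complex_norm_square of_real_mult sum_distrib_left mult.commute)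
    finally show ?thesis by (simp only: of_real_eq_iff)
  qed
  have "(\<Sum>j<l. \<Sum>a<p. \<Sum>b<q. (cmod (mode3 M E ! j $$ (a, b)))\<^sup>2)
      = (\<Sum>a<p. \<Sum>b<q. \<Sum>j<l. (cmod (mode3 M E ! j $$ (a, b)))\<^sup>2)"
    by (rule trans[OF sum.swap], rule sum.cong[OF refl], rule sum.swap)
  also have "\<dots> = \<rho> * (\<Sum>a<p. \<Sum>b<q. \<Sum>j<l. (cmod (E ! j $$ (a, b)))\<^sup>2)"
    by (simp add: parseval sum_distrib_left)
  also have "(\<Sum>a<p. \<Sum>b<q. \<Sum>j<l. (cmod (E ! j $$ (a, b)))\<^sup>2) = (tensor_norm E)\<^sup>2"
    using tensors_dims[OF E l] E by (simp add: tensor_norm_def tensors_def sum_nonneg)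
  finally show ?thesis using rho by simp
qed

section \<open>Real spectral theorem\<close>

text \<open>A list rather than a matrix with orthonormal columns, since families are built by
  appending vectors and only become bases at the end.\<close>

definition orthonormal :: "nat \<Rightarrow> real vec list \<Rightarrow> bool" where
  "orthonormal n us \<longleftrightarrow> set us \<subseteq> carrier_vec n \<and>
     (\<forall>i<length us. \<forall>j<length us. us ! i \<bullet> us ! j = of_bool (i = j))"

lemma scalar_prod_sum: "w \<in> carrier_vec n \<Longrightarrow> v \<bullet> w = (\<Sum>a<n. v $ a * w $ a)"
  by (auto simp: scalar_prod_def lessThan_atLeast0)

lemma orthonormal_nth_carrier: "orthonormal n us \<Longrightarrow> i < length us \<Longrightarrow> us ! i \<in> carrier_vec n"
  by (auto simp: orthonormal_def)

lemma orthonormal_inner: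
  assumes "orthonormal n us" "i < length us" "j < length us"
  shows "(\<Sum>a<n. us ! i $ a * us ! j $ a) = of_bool (i = j)"
  using assms scalar_prod_sum[OF orthonormal_nth_carrier[OF assms(1,3)], of "us ! i"]
  by (simp add: orthonormal_def)

text \<open>The square matrix with these rows has its transpose as right inverse, hence also as left
  inverse: its columns are orthonormal too.\<close>

lemma orthonormal_dual:
  assumes us: "orthonormal n us" "length us = n" and ab: "a < n" "b < n"
  shows "(\<Sum>i<n. us ! i $ a * us ! i $ b) = of_bool (a = b)"
proof -
  let ?W = "mat_of_rows n us"
  have W: "?W \<in> carrier_mat n n" using us by (simp add: carrier_matI)
  have idx: "?W $$ (i, a) = us ! i $ a" if "i < n" "a < n" for i a
    using that us by (simp add: mat_of_rows_def)
  have "?W * transpose_mat ?W = 1\<^sub>m n"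
  proof (rule eq_matI)
    fix i j assume ij: "i < dim_row (1\<^sub>m n :: real mat)" "j < dim_col (1\<^sub>m n :: real mat)"
    then have "(?W * transpose_mat ?W) $$ (i, j) = us ! i \<bullet> us ! j"
      using us W orthonormal_nth_carrier[OF us(1)] by simp
    then show "(?W * transpose_mat ?W) $$ (i, j) = 1\<^sub>m n $$ (i, j)"
      using us ij by (simp add: orthonormal_def)
  qed (use us in auto)
  then have "transpose_mat ?W * ?W = 1\<^sub>m n"
    using mat_mult_left_right_inverse W by (meson transpose_carrier_mat)
  then have "(transpose_mat ?W * ?W) $$ (a, b) = of_bool (a = b)"
    using ab by simp
  moreover have "(transpose_mat ?W * ?W) $$ (a, b) = (\<Sum>i<n. us ! i $ a * us ! i $ b)"
    using W ab us by (simp add: scalar_prod_def lessThan_atLeast0 idx)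
  ultimately show ?thesis by simp
qed

lemma orthonormal_expansion:
  assumes us: "orthonormal n us" "length us = n" and x: "x \<in> carrier_vec n" and a: "a < n"
  shows "x $ a = (\<Sum>i<n. (us ! i \<bullet> x) * us ! i $ a)"
proof -
  have "(\<Sum>i<n. (us ! i \<bullet> x) * us ! i $ a) = (\<Sum>i<n. \<Sum>b<n. us ! i $ b * x $ b * us ! i $ a)"
    by (simp add: scalar_prod_sum[OF x] sum_distrib_right)
  also have "\<dots> = (\<Sum>b<n. x $ b * (\<Sum>i<n. us ! i $ b * us ! i $ a))"
    by (subst sum.swap) (simp add: sum_distrib_left mult_ac)
  also have "\<dots> = x $ a"
    using a by (simp add: orthonormal_dual[OF us])
  finally show ?thesis ..
qed

lemma orthonormal_take: "orthonormal n us \<Longrightarrow> orthonormal n (take k us)"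
  by (auto simp: orthonormal_def dest: in_set_takeD)

text \<open>Otherwise the first n vectors already form a basis. Expanding the next one,
  \<open>us ! n\<close>, in it gives only zero coefficients, although its norm is 1.\<close>

lemma orthonormal_length_le:
  assumes us: "orthonormal n us"
  shows "length us \<le> n"
proof (rule ccontr)
  assume "\<not> length us \<le> n"
  then have n: "n < length us" by simp
  then have x: "us ! n \<in> carrier_vec n" using us orthonormal_nth_carrier by blast
  have "us ! n = 0\<^sub>v n"
  proof (rule eq_vecI)
    fix a assume "a < dim_vec (0\<^sub>v n :: real vec)"
    then have a: "a < n" by simp
    have "us ! n $ a = (\<Sum>i<n. (take n us ! i \<bullet> us ! n) * take n us ! i $ a)"
      using orthonormal_expansion[OF orthonormal_take[OF us] _ x a, of n] n by simp
    also have "\<dots> = 0"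
      using us n by (intro sum.neutral) (auto simp: orthonormal_def)
    finally show "us ! n $ a = 0\<^sub>v n $ a" using a by simp
  qed (use x in simp)
  then have "us ! n \<bullet> us ! n = 0" by simp
  then show False using us n by (simp add: orthonormal_def)
qed

lemma orthonormal_snoc:
  assumes "orthonormal n us" "v \<in> carrier_vec n" "v \<bullet> v = 1" "\<And>u. u \<in> set us \<Longrightarrow> u \<bullet> v = 0"
  shows "orthonormal n (us @ [v])"
proof -
  have "v \<bullet> u = 0" if "u \<in> set us" for u
    using that assms(1,2,4) comm_scalar_prod[of v n u] by (auto simp: orthonormal_def subset_iff)
  then show ?thesis
    using assms unfolding orthonormal_def
    by (auto simp: nth_append less_Suc_eq)
qed

lemma normalize_vec:
  fixes v :: "real vec"
  assumes "v \<in> carrier_vec n" "v \<noteq> 0\<^sub>v n"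
  obtains c where "c \<noteq> 0" "(c \<cdot>\<^sub>v v) \<bullet> (c \<cdot>\<^sub>v v) = 1"
proof -
  have "0 < v \<bullet> v"
    using assms conjugate_square_eq_0_vec[of v n] conjugate_square_ge_0_vec[of v]
    by (simp add: less_le)
  then show thesis
    using assms(1) by (intro that[of "1 / sqrt (v \<bullet> v)"]) (auto simp: real_sqrt_divide[symmetric] field_simps)
qed

lemma orthonormal_extend:
  assumes "orthonormal n us"
  obtains vs where "orthonormal n (us @ vs)" "length (us @ vs) = n"
proof -
  have "\<exists>vs. orthonormal n (us @ vs) \<and> length (us @ vs) = n"
    using assms
  proof (induction "n - length us" arbitrary: us)
    case 0
    then show ?case using orthonormal_length_le[of n us] by (intro exI[of _ "[]"]) auto
  next
    case (Suc d)
    \<comment> \<open>The given vectors as rows, padded with zero rows to a square matrix. At least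
      one zero row is present, so the matrix is singular, and a kernel vector is orthogonal to all
      given vectors.\<close>
    let ?A = "mat n n (\<lambda>(i, a). if i < length us then us ! i $ a else 0)"
    have "?A = mat\<^sub>r n n (\<lambda>i. if i = length us then 0\<^sub>v n else row ?A i)"
      by (intro eq_matI) auto
    also have "det \<dots> = 0"
      by (rule det_row_0) (use Suc(2) in auto)
    finally have "det ?A = 0" .
    then obtain v where v: "v \<in> carrier_vec n" "v \<noteq> 0\<^sub>v n" "?A *\<^sub>v v = 0\<^sub>v n"
      using det_0_iff_vec_prod_zero[of ?A n] by auto
    have orth: "u \<bullet> v = 0" if "u \<in> set us" for u
    proof -
      obtain i where i: "i < length us" "u = us ! i" using \<open>u \<in> set us\<close> by (auto simp: in_set_conv_nth)
      then have "row ?A i = u"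
        using Suc(2) orthonormal_nth_carrier[OF Suc(3) i(1)] by (intro eq_vecI) auto
      moreover have "(?A *\<^sub>v v) $ i = 0" using v(3) i Suc(2) by simp
      ultimately show ?thesis using i Suc(2) by simp
    qed
    obtain c where c: "c \<noteq> 0" "(c \<cdot>\<^sub>v v) \<bullet> (c \<cdot>\<^sub>v v) = 1" using normalize_vec v by blast
    have "orthonormal n (us @ [c \<cdot>\<^sub>v v])"
      using Suc(3) v c orth by (intro orthonormal_snoc) (auto simp: orthonormal_def subset_iff)
    moreover have "d = n - length (us @ [c \<cdot>\<^sub>v v])" using Suc(2) by simp
    ultimately show ?case using Suc(1) by fastforce
  qed
  then show thesis using that by blast
qed

text \<open>A complex eigenpair (c, v) exists by the fundamental theorem of algebra. The form v^H A
  v equals c |v|^2 and, by symmetry, is its own conjugate, so c is real. It is then a root of the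
  real characteristic polynomial, which supplies a new, real eigenvector.\<close>

lemma symmetric_real_eigenvector:
  fixes A :: "real mat"
  assumes A: "A \<in> carrier_mat n n" and n: "0 < n"
    and sym: "\<And>i j. i < n \<Longrightarrow> j < n \<Longrightarrow> A $$ (i, j) = A $$ (j, i)"
  obtains x c where "x \<in> carrier_vec n" "x \<noteq> 0\<^sub>v n" "A *\<^sub>v x = c \<cdot>\<^sub>v x"
proof -
  let ?B = "map_mat complex_of_real A"
  have B: "?B \<in> carrier_mat n n" using A by simp
  have "degree (char_poly ?B) = n" using degree_monic_char_poly[OF B] by simp
  then obtain c where root: "poly (char_poly ?B) c = 0"
    using fundamental_theorem_of_algebra_alt[of "char_poly ?B"] n
    by (metis degree_pCons_0 less_not_refl)
  then obtain v where v: "v \<in> carrier_vec n" "v \<noteq> 0\<^sub>v n" "?B *\<^sub>v v = c \<cdot>\<^sub>v v"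
    using eigenvalue_root_char_poly[OF B] B by (auto simp: eigenvalue_def eigenvector_def)
  let ?s = "\<Sum>i<n. cnj (v $ i) * v $ i"
  let ?h = "\<Sum>i<n. \<Sum>j<n. cnj (v $ i) * (A $$ (i, j) * v $ j)"
  have s: "?s = complex_of_real (\<Sum>i<n. (cmod (v $ i))\<^sup>2)"
    by (simp add: complex_norm_square[unfolded of_real_power] mult.commute[of "cnj _"])
  obtain i where i: "i < n" "v $ i \<noteq> 0" using v by (metis carrier_vecD eq_vecI index_zero_vec)
  then have "0 < (\<Sum>i<n. (cmod (v $ i))\<^sup>2)"
    by (intro sum_pos2[of _ i]) auto
  then have s0: "?s \<noteq> 0" by (simp only: s of_real_eq_0_iff)
  have Bv: "(\<Sum>j<n. A $$ (i, j) * v $ j) = c * v $ i" if "i < n" for i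
  proof -
    have "(?B *\<^sub>v v) $ i = (\<Sum>j<n. A $$ (i, j) * v $ j)"
      using that A v(1) by (simp add: scalar_prod_sum[OF v(1)])
    then show ?thesis using v that by simp
  qed
  have "?h = (\<Sum>i<n. cnj (v $ i) * (c * v $ i))"
    by (intro sum.cong refl) (simp add: Bv sum_distrib_left[symmetric])
  then have h: "?h = c * ?s" by (simp add: sum_distrib_left mult_ac)
  have "cnj ?h = (\<Sum>j<n. \<Sum>i<n. cnj (v $ j) * (A $$ (j, i) * v $ i))"
    by (subst sum.swap) (auto intro!: sum.cong simp: sym)
  then have "cnj (c * ?s) = c * ?s" by (simp only: h)
  then have "cnj c * ?s = c * ?s"
    by (simp only: s complex_cnj_mult complex_cnj_complex_of_real)
  then have "cnj c = c" using s0 by simp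
  then have "c = complex_of_real (Re c)" by (simp add: complex_eq_iff)
  then have "poly (map_poly complex_of_real (char_poly A)) (complex_of_real (Re c)) = 0"
    using root of_real_hom.char_poly_hom[OF A] by metis
  then have "poly (char_poly A) (Re c) = 0" by simp
  then have "eigenvalue A (Re c)" using eigenvalue_root_char_poly[OF A] by simp
  then show thesis using that A unfolding eigenvalue_def eigenvector_def by auto
qed

lemma scalar_prod_lincomb:
  fixes u :: "real vec"
  shows "u \<bullet> vec n (\<lambda>a. \<Sum>j<m. x j * v j $ a) = (\<Sum>j<m. x j * (\<Sum>a<n. u $ a * v j $ a))"
  by (subst scalar_prod_sum[of _ n], simp)
     (simp add: sum_distrib_left mult.left_commute sum.swap[of _ "{..<m}"])

lemma symmetric_scalar_prod:
  fixes A :: "real mat"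
  assumes "A \<in> carrier_mat n n" "transpose_mat A = A" "x \<in> carrier_vec n" "y \<in> carrier_vec n"
  shows "x \<bullet> (A *\<^sub>v y) = (A *\<^sub>v x) \<bullet> y"
  using transpose_vec_mult_scalar[OF assms(1,4,3)] assms(2) by simp

text \<open>An eigenvector of the compression of \<open>A\<close> to the orthogonal complement of the eigenvectors
  found so far is an eigenvector of \<open>A\<close>.\<close>

lemma symmetric_eigenvector_orthogonal:
  fixes A :: "real mat"
  assumes A: "A \<in> carrier_mat n n" and sym: "transpose_mat A = A"
    and us: "orthonormal n us" "length us < n"
    and ev: "\<And>u. u \<in> set us \<Longrightarrow> \<exists>c. A *\<^sub>v u = c \<cdot>\<^sub>v u"
  obtains w c where "orthonormal n (us @ [w])" "A *\<^sub>v w = c \<cdot>\<^sub>v w"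
proof -
  define r where "r = length us"
  obtain vs where W: "orthonormal n (us @ vs)" "length (us @ vs) = n"
    using orthonormal_extend[OF us(1)] by blast
  let ?W = "us @ vs"
  have Wc: "?W ! i \<in> carrier_vec n" if "i < n" for i
    using orthonormal_nth_carrier[OF W(1)] that W(2) by simp
  \<comment> \<open>The matrix of the compression in the basis \<open>vs\<close>; an eigenvector
    \<open>x\<close> of it is the coordinate list of \<open>w\<close>.\<close>
  let ?C = "mat (n - r) (n - r) (\<lambda>(i, j). ?W ! (r + i) \<bullet> (A *\<^sub>v ?W ! (r + j)))"
  have C: "?C \<in> carrier_mat (n - r) (n - r)" by simp
  have C_sym: "?C $$ (i, j) = ?C $$ (j, i)" if "i < n - r" "j < n - r" for i j
    using that symmetric_scalar_prod[OF A sym Wc Wc, of "r + i" "r + j"]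
      comm_scalar_prod[OF mult_mat_vec_carrier[OF A Wc] Wc, of "r + i" "r + j"] by simp
  have "0 < n - r" using us(2) by (simp add: r_def)
  then obtain x c where x: "x \<in> carrier_vec (n - r)" "x \<noteq> 0\<^sub>v (n - r)" "?C *\<^sub>v x = c \<cdot>\<^sub>v x"
    using symmetric_real_eigenvector[OF C _ C_sym] by blast
  define w where "w = vec n (\<lambda>a. \<Sum>j<n - r. x $ j * ?W ! (r + j) $ a)"
  have w: "w \<in> carrier_vec n" by (simp add: w_def)
  have Ww: "?W ! i \<bullet> w = (if i < r then 0 else x $ (i - r))" if "i < n" for i
  proof -
    have "?W ! i \<bullet> w = (\<Sum>j<n - r. x $ j * of_bool (i = r + j))"
      unfolding w_def scalar_prod_lincomb
      using that by (intro sum.cong refl) (subst orthonormal_inner[OF W(1)], use W(2) in auto)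
    also have "\<dots> = (\<Sum>j<n - r. if j = i - r \<and> r \<le> i then x $ j else 0)"
      by (intro sum.cong) auto
    also have "\<dots> = (if i < r then 0 else x $ (i - r))"
      using that by (auto simp: not_less)
    finally show ?thesis .
  qed
  \<comment> \<open>The vectors A w and c w have the same coordinates in the basis
    \<open>?W\<close>. Below \<open>r\<close> both coordinates are 0, because symmetry moves A onto
    an eigenvector orthogonal to \<open>w\<close>; from \<open>r\<close> on, this is the eigenvalue
    equation of \<open>?C\<close>.\<close>
  have WAw: "?W ! i \<bullet> (A *\<^sub>v w) = c * (?W ! i \<bullet> w)" if i: "i < n" for i
  proof (cases "i < r")
    case True
    then have "us ! i \<in> set us" by (simp add: r_def)
    with ev obtain d where "A *\<^sub>v us ! i = d \<cdot>\<^sub>v us ! i" by blast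
    then have "A *\<^sub>v ?W ! i = d \<cdot>\<^sub>v ?W ! i" using True by (simp add: nth_append r_def)
    then have "?W ! i \<bullet> (A *\<^sub>v w) = d * (?W ! i \<bullet> w)"
      using symmetric_scalar_prod[OF A sym Wc[OF i] w] Wc[OF i] w by simp
    then show ?thesis using Ww[OF i] True by simp
  next
    case False
    have "?W ! i \<bullet> (A *\<^sub>v w) = (A *\<^sub>v ?W ! i) \<bullet> w"
      by (rule symmetric_scalar_prod[OF A sym Wc[OF i] w])
    also have "\<dots> = (\<Sum>j<n - r. x $ j * ((A *\<^sub>v ?W ! i) \<bullet> ?W ! (r + j)))"
      unfolding w_def scalar_prod_lincomb
      by (intro sum.cong refl) (subst scalar_prod_sum[OF Wc], auto)
    also have "\<dots> = (\<Sum>j<n - r. ?C $$ (i - r, j) * x $ j)"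
      using False i by (intro sum.cong refl) (subst symmetric_scalar_prod[OF A sym Wc Wc, symmetric], auto)
    also have "\<dots> = (?C *\<^sub>v x) $ (i - r)"
      using False i by (simp add: scalar_prod_sum[OF x(1)])
    also have "\<dots> = c * x $ (i - r)" using False i x by simp
    finally show ?thesis using False Ww[OF i] by simp
  qed
  have Aw: "A *\<^sub>v w = c \<cdot>\<^sub>v w"
  proof (rule eq_vecI)
    fix a assume "a < dim_vec (c \<cdot>\<^sub>v w)"
    then have a: "a < n" using w by simp
    show "(A *\<^sub>v w) $ a = (c \<cdot>\<^sub>v w) $ a"
      using orthonormal_expansion[OF W mult_mat_vec_carrier[OF A w] a]
        orthonormal_expansion[OF W w a] a w
      by (simp add: WAw sum_distrib_left mult.assoc)
  qed (use A w in auto)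
  have w0: "w \<noteq> 0\<^sub>v n"
  proof
    assume "w = 0\<^sub>v n"
    have "x $ j = 0" if "j < n - r" for j
      using Ww[of "r + j"] that \<open>w = 0\<^sub>v n\<close> Wc[of "r + j"] by simp
    then have "x = 0\<^sub>v (n - r)" using x(1) by (intro eq_vecI) auto
    then show False using x(2) by simp
  qed
  obtain b where b: "b \<noteq> 0" "(b \<cdot>\<^sub>v w) \<bullet> (b \<cdot>\<^sub>v w) = 1" using normalize_vec w w0 by blast
  have "u \<bullet> (b \<cdot>\<^sub>v w) = 0" if "u \<in> set us" for u
  proof -
    obtain i where i: "i < length us" "u = us ! i" using \<open>u \<in> set us\<close> by (auto simp: in_set_conv_nth)
    then have "u \<bullet> w = 0" using Ww[of i] us(2) by (simp add: nth_append r_def)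
    moreover have "u \<in> carrier_vec n" using that us by (auto simp: orthonormal_def)
    ultimately show ?thesis using w by simp
  qed
  then have "orthonormal n (us @ [b \<cdot>\<^sub>v w])"
    using us w b by (intro orthonormal_snoc) auto
  moreover have "A *\<^sub>v (b \<cdot>\<^sub>v w) = c \<cdot>\<^sub>v (b \<cdot>\<^sub>v w)"
    using A w Aw by (simp add: mult_mat_vec smult_smult_assoc mult.commute)
  ultimately show thesis by (rule that)
qed

lemma symmetric_eigenbasis:
  fixes A :: "real mat"
  assumes A: "A \<in> carrier_mat n n" and sym: "transpose_mat A = A"
  obtains us where "orthonormal n us" "length us = n" "\<And>u. u \<in> set us \<Longrightarrow> \<exists>c. A *\<^sub>v u = c \<cdot>\<^sub>v u"
proof -
  \<comment> \<open>The induction is on the number of eigenvectors already found, with matrix and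
    space fixed.\<close>
  have "\<exists>us. orthonormal n us \<and> length us = r \<and> (\<forall>u\<in>set us. \<exists>c. A *\<^sub>v u = c \<cdot>\<^sub>v u)" if "r \<le> n" for r
    using that
  proof (induction r)
    case 0
    then show ?case by (auto simp: orthonormal_def)
  next
    case (Suc r)
    then obtain us where us: "orthonormal n us" "length us = r" "\<forall>u\<in>set us. \<exists>c. A *\<^sub>v u = c \<cdot>\<^sub>v u"
      by auto
    then obtain w c where "orthonormal n (us @ [w])" "A *\<^sub>v w = c \<cdot>\<^sub>v w"
      using symmetric_eigenvector_orthogonal[OF A sym us(1)] Suc(2) by auto
    then show ?case using us by (intro exI[of _ "us @ [w]"]) auto
  qed
  then show thesis using that by blast
qed

lemma symmetric_eigenbasis_sorted:
  fixes A :: "real mat"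
  assumes A: "A \<in> carrier_mat n n" and sym: "transpose_mat A = A"
  obtains us ls where "orthonormal n us" "length us = n" "length ls = n" "sorted_wrt (\<ge>) ls"
    "\<And>i. i < n \<Longrightarrow> A *\<^sub>v us ! i = ls ! i \<cdot>\<^sub>v us ! i"
proof -
  obtain us where us: "orthonormal n us" "length us = n" "\<And>u. u \<in> set us \<Longrightarrow> \<exists>c. A *\<^sub>v u = c \<cdot>\<^sub>v u"
    using symmetric_eigenbasis[OF A sym] by blast
  then obtain ev where ev: "\<And>u. u \<in> set us \<Longrightarrow> A *\<^sub>v u = ev u \<cdot>\<^sub>v u" by metis
  \<comment> \<open>\<open>ev\<close> depends on the vector and not on its index, so the eigenvalues
    move along with the sorted vectors. Sorting is increasing, hence the reversal.\<close>
  let ?vs = "rev (sort_key ev us)"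
  have "mset ?vs = mset us" by simp
  then obtain p where p: "p permutes {..<length us}" "permute_list p us = ?vs"
    by (rule mset_eq_permutation)
  have nth: "?vs ! i = us ! p i" if "i < n" for i
    using permute_list_nth[OF p(1), of i] p(2) that us(2) by simp
  have pn: "p i < n" if "i < n" for i
    using permutes_in_image[OF p(1), of i] that us(2) by simp
  have "orthonormal n ?vs"
    unfolding orthonormal_def
  proof (intro conjI allI impI)
    show "set ?vs \<subseteq> carrier_vec n" using us(1) by (auto simp: orthonormal_def)
    fix i j assume "i < length ?vs" "j < length ?vs"
    then have ij: "i < n" "j < n" using us(2) by auto
    then have "?vs ! i \<bullet> ?vs ! j = of_bool (p i = p j)"
      using us(1,2) pn by (simp only: nth) (simp add: orthonormal_def)
    also have "p i = p j \<longleftrightarrow> i = j"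
      using permutes_inj[OF p(1)] by (auto dest: injD)
    finally show "?vs ! i \<bullet> ?vs ! j = of_bool (i = j)" .
  qed
  moreover have "sorted_wrt (\<ge>) (map ev ?vs)"
    using sorted_sort_key[of ev us] by (simp add: rev_map[symmetric] sorted_wrt_rev)
  moreover have "A *\<^sub>v ?vs ! i = map ev ?vs ! i \<cdot>\<^sub>v ?vs ! i" if "i < n" for i
    using that ev[of "?vs ! i"] nth_mem[of i ?vs] us(2) by simp
  ultimately show thesis using us(2) by (intro that[of ?vs "map ev ?vs"]) auto
qed

text \<open>Row a of A is expanded in the eigenbasis; its i-th coefficient is entry a of A u_i, that
  is \<open>ls ! i * us ! i $ a\<close>.\<close>

lemma symmetric_spectral_sum:
  fixes A :: "real mat"
  assumes A: "A \<in> carrier_mat n n" and sym: "transpose_mat A = A"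
    and us: "orthonormal n us" "length us = n"
    and ev: "\<And>i. i < n \<Longrightarrow> A *\<^sub>v us ! i = ls ! i \<cdot>\<^sub>v us ! i"
    and ab: "a < n" "b < n"
  shows "A $$ (a, b) = (\<Sum>i<n. us ! i $ a * ls ! i * us ! i $ b)"
proof -
  have uc: "us ! i \<in> carrier_vec n" if "i < n" for i
    using orthonormal_nth_carrier us that by auto
  have "us ! i \<bullet> row A a = ls ! i * us ! i $ a" if i: "i < n" for i
  proof -
    have "us ! i \<bullet> row A a = (A *\<^sub>v us ! i) $ a"
      using A ab uc[OF i] comm_scalar_prod[of "us ! i" n "row A a"] by simp
    then show ?thesis using ev[OF i] uc[OF i] ab by simp
  qed
  then show ?thesis
    using orthonormal_expansion[OF us, of "row A a" b] A ab by (simp add: mult_ac)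
qed

text \<open>With the eigenvectors as columns of \<open>P\<close>, A = P D P^T is similar to the
  diagonal matrix of \<open>ls\<close>. So \<open>ls\<close> lists the roots with algebraic
  multiplicity, as \<open>singular_values\<close> counts them.\<close>

lemma char_poly_eigenbasis:
  fixes A :: "real mat"
  assumes A: "A \<in> carrier_mat n n" and sym: "transpose_mat A = A"
    and us: "orthonormal n us" "length us = n" and ls: "length ls = n"
    and ev: "\<And>i. i < n \<Longrightarrow> A *\<^sub>v us ! i = ls ! i \<cdot>\<^sub>v us ! i"
  shows "char_poly A = (\<Prod>c\<leftarrow>ls. [:- c, 1:])"
proof -
  define D where "D = mat n n (\<lambda>(i, j). if i = j then ls ! i else 0)"
  define P where "P = mat n n (\<lambda>(a, i). us ! i $ a)"
  have carr: "D \<in> carrier_mat n n" "P \<in> carrier_mat n n" "transpose_mat P \<in> carrier_mat n n"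
    by (auto simp: D_def P_def)
  have "transpose_mat P * P = 1\<^sub>m n"
    using orthonormal_inner[OF us(1)] us(2)
    by (intro eq_matI) (auto simp: P_def scalar_prod_def lessThan_atLeast0)
  moreover have "P * transpose_mat P = 1\<^sub>m n"
    using orthonormal_dual[OF us]
    by (intro eq_matI) (auto simp: P_def scalar_prod_def lessThan_atLeast0)
  moreover have "P * D = mat n n (\<lambda>(a, i). us ! i $ a * ls ! i)"
    by (intro eq_matI) (auto simp: P_def D_def scalar_prod_def if_distrib cong: if_cong)
  then have "P * D * transpose_mat P = A"
    using A symmetric_spectral_sum[OF A sym us ev]
    by (intro eq_matI) (auto simp: P_def scalar_prod_def lessThan_atLeast0)
  ultimately have "similar_mat A D"
    using A carr by (intro similar_matI[of _ _ P "transpose_mat P" n]) auto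
  then have "char_poly A = char_poly D" by (rule char_poly_similar)
  also have "\<dots> = (\<Prod>c\<leftarrow>diag_mat D. [:- c, 1:])"
    by (rule char_poly_upper_triangular[OF carr(1)]) (auto simp: D_def upper_triangular_def)
  also have "diag_mat D = ls"
    using ls by (intro nth_equalityI) (auto simp: diag_mat_def D_def)
  finally show ?thesis .
qed

section \<open>Singular value decomposition\<close>

lemma sorted_desc_eq_rev_sort: "sorted_wrt (\<ge>) xs \<Longrightarrow> rev (sort xs) = xs" for xs :: "real list"
  by (subst properties_for_sort[of "rev xs"]) (simp_all add: sorted_wrt_rev)

lemma proots_linear_factors: "proots (\<Prod>c\<leftarrow>cs. [:- c, 1:]) = mset cs" for cs :: "complex list"
proof (induction cs)
  case (Cons c cs)
  have "(\<Prod>c\<leftarrow>cs. [:- c, 1:]) \<noteq> 0" by (auto simp: prod_list_zero_iff)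
  then show ?case using Cons by (simp add: proots_mult del: mult_pCons_left)
qed simp

text \<open>For a real matrix the adjoint is the transpose, so the complex Gram matrix is the
  embedded real one and has the same linear factors. A list already in decreasing order is returned
  unchanged by the sorting in \<open>singular_values\<close>.\<close>

lemma singular_values_of_real_mat:
  assumes R: "R \<in> carrier_mat m n"
    and cp: "char_poly (transpose_mat R * R) = (\<Prod>c\<leftarrow>ls. [:- c, 1:])"
    and ls: "sorted_wrt (\<ge>) ls"
  shows "singular_values (map_mat complex_of_real R) = take (min m n) (map sqrt ls)"
proof -
  let ?h = complex_of_real
  let ?X = "map_mat ?h R"
  interpret map_poly_of_real: map_poly_comm_ring_hom ?h ..
  have "mat_adjoint ?X = map_mat ?h (transpose_mat R)"
    using R by (intro eq_matI) (auto simp: mat_adjoint_def mat_of_rows_def)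
  then have G: "mat_adjoint ?X * ?X = map_mat ?h (transpose_mat R * R)"
    using of_real_hom.mat_hom_mult[where 'a = complex, of "transpose_mat R" n m R n] R by simp
  have "char_poly (mat_adjoint ?X * ?X) = map_poly ?h (\<Prod>c\<leftarrow>ls. [:- c, 1:])"
    unfolding G cp[symmetric] by (rule of_real_hom.char_poly_hom) (use R in auto)
  also have "\<dots> = (\<Prod>c\<leftarrow>map ?h ls. [:- c, 1:])"
    by (simp add: map_poly_of_real.hom_prod_list o_def)
  finally have "proots (char_poly (mat_adjoint ?X * ?X)) = mset (map ?h ls)"
    by (simp only: proots_linear_factors)
  then have "image_mset (\<lambda>z. sqrt (Re z)) (proots (char_poly (mat_adjoint ?X * ?X))) = mset (map sqrt ls)"
    by (simp add: image_mset.compositionality o_def)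
  \<comment> \<open>\<open>sqrt\<close> is monotone on all reals, negative ones included, so the
    order survives.\<close>
  moreover have "sorted_wrt (\<ge>) (map sqrt ls)"
    using ls by (simp add: sorted_wrt_map)
  ultimately show ?thesis
    using R by (simp add: singular_values_def sorted_desc_eq_rev_sort sorted_list_of_multiset_mset del: mset_map)
qed

text \<open>The right vectors are an eigenbasis w_i of the Gram matrix. Their images R w_i are
  pairwise orthogonal with squared lengths the eigenvalues; the nonzero ones, normalized, are the
  first left vectors, and the rest is any orthonormal completion. \<open>sig\<close> keeps all n
  roots, so only its first \<open>min m n\<close> entries count as singular values.\<close>

lemma real_svd:
  fixes R :: "real mat"
  assumes R: "R \<in> carrier_mat m n"
  obtains us ws sig where "orthonormal m us" "length us = m" "orthonormal n ws" "length ws = n"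
    "length sig = n" "singular_values (map_mat complex_of_real R) = take (min m n) sig"
    "\<And>a c. a < m \<Longrightarrow> c < n \<Longrightarrow> R $$ (a, c) = (\<Sum>i<min m n. us ! i $ a * sig ! i * ws ! i $ c)"
proof -
  let ?G = "transpose_mat R * R"
  have G: "?G \<in> carrier_mat n n" using R by simp
  have "transpose_mat ?G = ?G" using R by (simp add: transpose_mult[of _ n m _ n])
  then obtain ws ls where ws: "orthonormal n ws" "length ws = n" and ls: "length ls = n" "sorted_wrt (\<ge>) ls"
    and ev: "\<And>i. i < n \<Longrightarrow> ?G *\<^sub>v ws ! i = ls ! i \<cdot>\<^sub>v ws ! i"
    and cp: "char_poly ?G = (\<Prod>c\<leftarrow>ls. [:- c, 1:])"
    using symmetric_eigenbasis_sorted[OF G] char_poly_eigenbasis[OF G] by metis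
  let ?sig = "map sqrt ls"
  define y where "y i = R *\<^sub>v ws ! i" for i
  have wc: "ws ! i \<in> carrier_vec n" if "i < n" for i
    using orthonormal_nth_carrier ws that by auto
  have yc: "y i \<in> carrier_vec m" if "i < n" for i
    using R wc[OF that] by (simp add: y_def)
  have yy: "y i \<bullet> y j = ls ! i * of_bool (i = j)" if ij: "i < n" "j < n" for i j
  proof -
    have "y i \<bullet> y j = (transpose_mat R *\<^sub>v y i) \<bullet> ws ! j"
      using transpose_vec_mult_scalar[OF R wc[OF ij(2)] yc[OF ij(1)]] by (simp add: y_def)
    also have "transpose_mat R *\<^sub>v y i = ?G *\<^sub>v ws ! i"
      using R wc[OF ij(1)] by (simp add: y_def assoc_mult_mat_vec[of _ n m _ n])
    finally show ?thesis
      using ev[OF ij(1)] ws ij smult_scalar_prod_distrib[OF wc[OF ij(1)] wc[OF ij(2)]]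
      by (simp add: orthonormal_def)
  qed
  have nonneg: "0 \<le> ls ! i" if "i < n" for i
    using yy[OF that that] conjugate_square_ge_0_vec[of "y i"] by simp
  \<comment> \<open>The rank of \<open>R\<close>: the eigenvalues are nonnegative and decreasing, so
    the positive ones form a prefix.\<close>
  define r where "r = length (takeWhile (\<lambda>c. 0 < c) ls)"
  have r: "r \<le> n" using length_takeWhile_le[of _ ls] by (simp add: r_def ls(1))
  have pos: "0 < ls ! i" if "i < r" for i
    using that nth_mem[of i "takeWhile (\<lambda>c. 0 < c) ls"] set_takeWhileD takeWhile_nth
    unfolding r_def by metis
  have zero: "ls ! i = 0" if "r \<le> i" "i < n" for i
  proof -
    have "ls ! r \<le> 0"
      using that ls(1) nth_length_takeWhile[of "\<lambda>c. 0 < c" ls] by (simp add: r_def)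
    moreover have "ls ! i \<le> ls ! r"
      using that ls sorted_wrt_nth_less[OF ls(2), of r i] by (cases "i = r") auto
    ultimately show ?thesis using nonneg[OF that(2)] by simp
  qed
  define us where "us = map (\<lambda>i. (1 / ?sig ! i) \<cdot>\<^sub>v y i) [0..<r]"
  have "orthonormal m us"
    unfolding orthonormal_def
  proof (intro conjI allI impI)
    show "set us \<subseteq> carrier_vec m" using yc r by (auto simp: us_def)
    fix i j assume "i < length us" "j < length us"
    then have ij: "i < r" "j < r" "i < n" "j < n" using r by (auto simp: us_def)
    have "sqrt (ls ! i) * sqrt (ls ! i) = ls ! i" using nonneg[OF ij(3)] by simp
    then show "us ! i \<bullet> us ! j = of_bool (i = j)"
      using ij yy[OF ij(3,4)] yc[OF ij(3)] yc[OF ij(4)] ls(1) pos[OF ij(1)]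
      by (auto simp: us_def field_simps)
  qed
  then obtain vs where U: "orthonormal m (us @ vs)" "length (us @ vs) = m"
    by (rule orthonormal_extend)
  \<comment> \<open>Together with \<open>r \<le> n\<close> this lets the sum over the first
    \<open>r\<close> terms be padded with zeros up to \<open>min m n\<close>.\<close>
  then have rm: "r \<le> m" by (simp add: us_def)
  have yU: "y i $ a = (us @ vs) ! i $ a * ?sig ! i" if "i < r" "a < m" for i a
    using that r yc[of i] ls(1) pos[OF that(1)] by (simp add: us_def nth_append)
  have y0: "y i $ a = 0" if "r \<le> i" "i < n" "a < m" for i a
    using that zero[OF that(1,2)] yy[of i i] yc[OF that(2)] conjugate_square_eq_0_vec[of "y i" m] by simp
  have dec: "R $$ (a, c) = (\<Sum>i<min m n. (us @ vs) ! i $ a * ?sig ! i * ws ! i $ c)"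
    if ac: "a < m" "c < n" for a c
  proof -
    have "row R a $ c = (\<Sum>i<n. (ws ! i \<bullet> row R a) * ws ! i $ c)"
      using R ac by (intro orthonormal_expansion[OF ws]) auto
    also have "\<dots> = (\<Sum>i<n. y i $ a * ws ! i $ c)"
      using R ac wc by (intro sum.cong) (auto simp: y_def comm_scalar_prod[of _ n "row R a"])
    \<comment> \<open>From index \<open>r\<close> on the eigenvalue is 0, so R w_i has length
      0.\<close>
    also have "\<dots> = (\<Sum>i<r. y i $ a * ws ! i $ c)"
      using r y0 ac by (intro sum.mono_neutral_right) auto
    also have "\<dots> = (\<Sum>i<r. (us @ vs) ! i $ a * ?sig ! i * ws ! i $ c)"
      using yU ac by simp
    also have "\<dots> = (\<Sum>i<min m n. (us @ vs) ! i $ a * ?sig ! i * ws ! i $ c)"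
      using r rm zero ls(1) by (intro sum.mono_neutral_left) auto
    finally show ?thesis using R ac by simp
  qed
  have "length ?sig = n" using ls(1) by simp
  then show thesis
    by (rule that[OF U ws _ singular_values_of_real_mat[OF R cp ls(2)] dec])
qed

text \<open>The matrices u_i w_i^T are orthonormal for the Frobenius inner product, so this is the
  theorem of Pythagoras. The free index set \<open>I\<close> allows its use on the tail of a
  decomposition.\<close>

lemma orthonormal_sum_norm:
  assumes us: "orthonormal m us" and ws: "orthonormal n ws"
    and I: "finite I" "\<And>i. i \<in> I \<Longrightarrow> i < length us" "\<And>i. i \<in> I \<Longrightarrow> i < length ws"
  shows "(\<Sum>p<m. \<Sum>q<n. (\<Sum>i\<in>I. us ! i $ p * s i * ws ! i $ q)\<^sup>2) = (\<Sum>i\<in>I. (s i)\<^sup>2)"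
proof -
  have "(\<Sum>p<m. \<Sum>q<n. (\<Sum>i\<in>I. us ! i $ p * s i * ws ! i $ q)\<^sup>2)
      = (\<Sum>p<m. \<Sum>q<n. \<Sum>i\<in>I. \<Sum>j\<in>I. s i * s j * (us ! i $ p * us ! j $ p) * (ws ! i $ q * ws ! j $ q))"
    by (simp add: power2_eq_square sum_product mult_ac)
  also have "\<dots> = (\<Sum>p<m. \<Sum>i\<in>I. \<Sum>j\<in>I. \<Sum>q<n. s i * s j * (us ! i $ p * us ! j $ p) * (ws ! i $ q * ws ! j $ q))"
    by (rule sum.cong[OF refl], rule trans[OF sum.swap], rule sum.cong[OF refl], rule sum.swap)
  also have "\<dots> = (\<Sum>i\<in>I. \<Sum>j\<in>I. \<Sum>p<m. \<Sum>q<n. s i * s j * (us ! i $ p * us ! j $ p) * (ws ! i $ q * ws ! j $ q))"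
    by (rule trans[OF sum.swap], rule sum.cong[OF refl], rule sum.swap)
  also have "\<dots> = (\<Sum>i\<in>I. \<Sum>j\<in>I. s i * s j * ((\<Sum>p<m. us ! i $ p * us ! j $ p) * (\<Sum>q<n. ws ! i $ q * ws ! j $ q)))"
    unfolding sum_product by (simp only: sum_distrib_left mult.assoc)
  also have "\<dots> = (\<Sum>i\<in>I. \<Sum>j\<in>I. if i = j then (s i)\<^sup>2 else 0)"
    using I by (intro sum.cong refl) (auto simp: orthonormal_inner[OF us] orthonormal_inner[OF ws] power2_eq_square)
  also have "\<dots> = (\<Sum>i\<in>I. (s i)\<^sup>2)" using I(1) by simp
  finally show ?thesis .
qed

section \<open>Factorization of a frontal slice\<close>

lemma of_real_Re_mat: "elements_mat X \<subseteq> \<real> \<Longrightarrow> map_mat complex_of_real (map_mat Re X) = X"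
  using elements_mat_subset[of X "dim_row X" "dim_col X" "\<real>"] by (intro eq_matI) auto

text \<open>The inner index k * s + h splits into the pair (k, h), and the resulting double sum
  factors.\<close>

lemma kron_mult:
  assumes "X \<in> carrier_mat p q" "Y \<in> carrier_mat r s" "X' \<in> carrier_mat q t" "Y' \<in> carrier_mat s u"
  shows "kron X Y * kron X' Y' = kron (X * X') (Y * Y')"
proof (rule eq_matI)
  note c = kron_carrier[OF assms(1,2)] kron_carrier[OF assms(3,4)]
  note XX = mult_carrier_mat[OF assms(1,3)] mult_carrier_mat[OF assms(2,4)]
  fix i j assume "i < dim_row (kron (X * X') (Y * Y'))" "j < dim_col (kron (X * X') (Y * Y'))"
  then have ij: "i < p * r" "j < t * u" using kron_carrier[OF XX] by auto
  then have "0 < r" "0 < u" by (auto intro: Nat.gr0I)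
  then have dm: "i div r < p" "j div u < t" "i mod r < r" "j mod u < u"
    using ij by (auto simp: less_mult_imp_div_less)
  have "(kron X Y * kron X' Y') $$ (i, j) = (\<Sum>k<q * s. kron X Y $$ (i, k) * kron X' Y' $$ (k, j))"
    using c ij by (simp add: scalar_prod_def lessThan_atLeast0)
  also have "\<dots> = (\<Sum>k<q. \<Sum>h<s. X $$ (i div r, k) * Y $$ (i mod r, h) * (X' $$ (k, j div u) * Y' $$ (h, j mod u)))"
    unfolding sum_lessThan_mult using ij assms
    by (intro sum.cong refl) (simp add: kron_index[OF assms(1,2)] kron_index[OF assms(3,4)] mult_add_less)
  also have "\<dots> = (\<Sum>k<q. X $$ (i div r, k) * X' $$ (k, j div u)) * (\<Sum>h<s. Y $$ (i mod r, h) * Y' $$ (h, j mod u))"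
    by (simp add: sum_product mult_ac)
  also have "\<dots> = (X * X') $$ (i div r, j div u) * (Y * Y') $$ (i mod r, j mod u)"
    using dm assms by (simp add: scalar_prod_def lessThan_atLeast0)
  also have "\<dots> = kron (X * X') (Y * Y') $$ (i, j)"
    using kron_index[OF XX ij] by simp
  finally show "(kron X Y * kron X' Y') $$ (i, j) = kron (X * X') (Y * Y') $$ (i, j)" .
qed (use kron_carrier[OF assms(1,2)] kron_carrier[OF assms(3,4)]
    kron_carrier[OF mult_carrier_mat[OF assms(1,3)] mult_carrier_mat[OF assms(2,4)]] in auto)

text \<open>Block (a, b) of the Kronecker product is \<open>D $$ (a, b)\<close> times
  \<open>C\<close>.\<close>

lemma kron_diagonal_block_diagonal:
  assumes D: "D \<in> carrier_mat m1 n1" and C: "C \<in> carrier_mat m2 n2"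
    and diag: "\<And>i j. i < m1 \<Longrightarrow> j < n1 \<Longrightarrow> i \<noteq> j \<Longrightarrow> D $$ (i, j) = 0"
  shows "block_diagonal m1 m2 n1 n2 (kron D C)"
  unfolding block_diagonal_def
proof (intro conjI allI impI)
  show "kron D C \<in> carrier_mat (m1 * m2) (n1 * n2)" using D C by (rule kron_carrier)
  fix a b assume "a < m1" "b < n1" "a \<noteq> b"
  then show "mat_block m2 n2 (kron D C) a b = 0\<^sub>m m2 n2"
    using diag by (intro eq_matI) (auto simp: mat_block_def kron_index[OF D C] mult_add_less)
qed

lemma real_orthogonal_orthonormal:
  assumes "orthonormal n us" "length us = n"
  shows "real_orthogonal n (mat n n (\<lambda>(a, i). complex_of_real (us ! i $ a)))" (is "real_orthogonal n ?P")
proof -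
  have "transpose_mat ?P * ?P = 1\<^sub>m n"
    using orthonormal_inner[OF assms(1)] assms(2)
    by (intro eq_matI) (auto simp: scalar_prod_def lessThan_atLeast0 simp flip: of_real_mult of_real_sum)
  moreover have "?P * transpose_mat ?P = 1\<^sub>m n"
    using orthonormal_dual[OF assms]
    by (intro eq_matI) (auto simp: scalar_prod_def lessThan_atLeast0 simp flip: of_real_mult of_real_sum)
  ultimately show ?thesis by (auto simp: real_orthogonal_def elements_mat_def)
qed

lemma kron_factorization:
  assumes B: "B \<in> carrier_mat m1 n1" "elements_mat B \<subseteq> \<real>"
    and C: "C \<in> carrier_mat m2 n2" "elements_mat C \<subseteq> \<real>"
  obtains U S V where "real_orthogonal m1 U" "real_orthogonal n1 V"
    "block_diagonal m1 m2 n1 n2 S" "elements_mat S \<subseteq> \<real>"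
    "kron U (1\<^sub>m m2) * S * kron (transpose_mat V) (1\<^sub>m n2) = kron B C"
proof -
  let ?R = "map_mat Re B"
  have R: "?R \<in> carrier_mat m1 n1" using B by simp
  obtain us ws sig where us: "orthonormal m1 us" "length us = m1" and ws: "orthonormal n1 ws" "length ws = n1"
    and svd: "\<And>a c. a < m1 \<Longrightarrow> c < n1 \<Longrightarrow> ?R $$ (a, c) = (\<Sum>i<min m1 n1. us ! i $ a * sig ! i * ws ! i $ c)"
    by (rule real_svd[OF R]) blast
  define U where "U = mat m1 m1 (\<lambda>(a, i). complex_of_real (us ! i $ a))"
  define V where "V = mat n1 n1 (\<lambda>(a, i). complex_of_real (ws ! i $ a))"
  define D where "D = mat m1 n1 (\<lambda>(i, j). if i = j then complex_of_real (sig ! i) else 0)"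
  have carr: "U \<in> carrier_mat m1 m1" "D \<in> carrier_mat m1 n1" "transpose_mat V \<in> carrier_mat n1 n1"
    by (auto simp: U_def V_def D_def)
  have B_eq: "U * D * transpose_mat V = B"
  proof (rule eq_matI)
    fix a c assume "a < dim_row B" "c < dim_col B"
    then have ac: "a < m1" "c < n1" using B by auto
    \<comment> \<open>\<open>D\<close> is rectangular: if n1 > m1, its columns from m1 on are zero.
      This reconciles the sum over n1 with the bound \<open>min m1 n1\<close> of the
      decomposition.\<close>
    have UD: "(U * D) $$ (a, j) = (if j < m1 then complex_of_real (us ! j $ a * sig ! j) else 0)" if "j < n1" for j
      using ac that by (auto simp: U_def D_def scalar_prod_def if_distrib cong: if_cong)
    have "(U * D * transpose_mat V) $$ (a, c)
        = (\<Sum>j<n1. (if j < m1 then complex_of_real (us ! j $ a * sig ! j) else 0) * complex_of_real (ws ! j $ c))"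
      using carr ac UD by (simp add: scalar_prod_def lessThan_atLeast0 V_def del: index_mult_mat(1))
        (simp add: index_mult_mat(1)[of a "U * D"] scalar_prod_def)
    also have "\<dots> = (\<Sum>j<min m1 n1. complex_of_real (us ! j $ a * sig ! j * ws ! j $ c))"
      by (intro sum.mono_neutral_cong_right) auto
    also have "\<dots> = complex_of_real (?R $$ (a, c))" by (simp add: svd[OF ac])
    also have "\<dots> = B $$ (a, c)" using of_real_Re_mat[OF B(2)] B(1) ac by (metis carrier_matD index_map_mat(1,2,3))
    finally show "(U * D * transpose_mat V) $$ (a, c) = B $$ (a, c)" .
  qed (use carr B in auto)
  have "kron U (1\<^sub>m m2) * kron D C * kron (transpose_mat V) (1\<^sub>m n2) = kron B C"
    using kron_mult[OF carr(1) one_carrier_mat[of m2] carr(2) C(1)]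
      kron_mult[OF mult_carrier_mat[OF carr(1,2)] C(1) carr(3) one_carrier_mat[of n2]] B_eq C(1)
    by simp
  moreover have "block_diagonal m1 m2 n1 n2 (kron D C)"
    by (rule kron_diagonal_block_diagonal[OF carr(2) C(1)]) (simp add: D_def)
  moreover have "elements_mat (kron D C) \<subseteq> \<real>"
  proof -
    have "kron D C $$ (i, j) \<in> \<real>" if ij: "i < m1 * m2" "j < n1 * n2" for i j
    proof -
      have "0 < m2" "0 < n2" using ij by (auto intro: Nat.gr0I)
      then have "i div m2 < m1" "j div n2 < n1" "i mod m2 < m2" "j mod n2 < n2"
        using ij by (auto simp: less_mult_imp_div_less)
      then show ?thesis
        using C(2) unfolding kron_index[OF carr(2) C(1) ij] elements_mat_subset[OF C(1)]
        by (auto simp: D_def)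
    qed
    then show ?thesis using elements_mat_subset[OF kron_carrier[OF carr(2) C(1)]] by simp
  qed
  ultimately show thesis
    using that real_orthogonal_orthonormal[OF us] real_orthogonal_orthonormal[OF ws]
    unfolding U_def V_def by blast
qed

section \<open>The rearrangement as a permutation of entries\<close>

lemma nth_concat_map_upt:
  assumes "a < m" "b < n"
  shows "concat (map (\<lambda>b. map (f b) [0..<m]) [0..<n]) ! (b * m + a) = f b a"
  using assms
proof (induction n)
  case (Suc n)
  let ?xs = "concat (map (\<lambda>b. map (f b) [0..<m]) [0..<n])"
  have len: "length ?xs = n * m" by (simp add: length_concat o_def sum_list_triv)
  show ?case
  proof (cases "b < n")
    case True
    then show ?thesis using Suc mult_add_less[OF True Suc(2)] len by (simp add: nth_append)
  next
    case False
    then have "b = n" using Suc by simp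
    then show ?thesis using Suc(2) len by (simp add: nth_append)
  qed
qed simp

lemma rearrange_carrier: "rearrange m1 m2 n1 n2 X \<in> carrier_mat (m1 * n1) (m2 * n2)"
  by (simp add: rearrange_def carrier_matI length_concat o_def sum_list_triv mult.commute)

text \<open>The position (a, b) of a block becomes the row and the position (r, c) inside the block
  becomes the column, both in column-major order: block columns are stacked, and so are the columns
  within \<open>vec_cols\<close>.\<close>

lemma rearrange_index:
  assumes "a < m1" "b < n1" "r < m2" "c < n2"
  shows "rearrange m1 m2 n1 n2 X $$ (b * m1 + a, c * m2 + r) = X $$ (a * m2 + r, b * n2 + c)"
proof -
  have "b * m1 + a < n1 * m1" "c * m2 + r < n2 * m2" using assms by (auto intro: mult_add_less)
  then show ?thesis
    using assms nth_concat_map_upt[OF assms(1,2), of "\<lambda>b a. vec_cols (mat_block m2 n2 X a b)"]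
    by (simp add: rearrange_def mat_of_rows_def length_concat o_def sum_list_triv vec_cols_def mat_block_def mult.commute)
qed

text \<open>Covers \<open>k > n\<close> as well: the head is padded with zeros and the tail is
  empty. This is what admits any number k of summands.\<close>

lemma sum_lessThan_split:
  "(\<Sum>i<n. f i) = (\<Sum>i<k. if i < n then f i else 0) + (\<Sum>i=k..<n. f i)"
  for f :: "nat \<Rightarrow> 'a::comm_monoid_add"
proof (cases "k \<le> n")
  case True
  then show ?thesis by (simp add: lessThan_atLeast0 sum.atLeastLessThan_concat)
next
  case False
  then have "(\<Sum>i<n. f i) = (\<Sum>i<k. if i < n then f i else 0)"
    by (intro sum.mono_neutral_cong_left) auto
  with False show ?thesis by simp
qed

text \<open>The factors are functions on all of \<open>nat\<close>, so nothing has to be said about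
  the range of i; beyond the last singular value the Kronecker product is zero.\<close>

lemma slice_factorization:
  assumes X: "X \<in> carrier_mat (m1 * m2) (n1 * n2)" "elements_mat X \<subseteq> \<real>"
  obtains U S V Z where "\<And>i. real_orthogonal m1 (U i)" "\<And>i. real_orthogonal n1 (V i)"
    "\<And>i. block_diagonal m1 m2 n1 n2 (S i)" "\<And>i. elements_mat (S i) \<subseteq> \<real>"
    "Z \<in> carrier_mat (m1 * m2) (n1 * n2)" "elements_mat Z \<subseteq> \<real>"
    "\<And>x y. x < m1 * m2 \<Longrightarrow> y < n1 * n2 \<Longrightarrow>
       X $$ (x, y) = (\<Sum>i=1..k. (kron (U i) (1\<^sub>m m2) * S i * kron (transpose_mat (V i)) (1\<^sub>m n2)) $$ (x, y))
         + Z $$ (x, y)"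
    "(\<Sum>x<m1 * m2. \<Sum>y<n1 * n2. (cmod (Z $$ (x, y)))\<^sup>2)
       = (\<Sum>i=k+1..min (m1 * n1) (m2 * n2). (singular_values (rearrange m1 m2 n1 n2 X) ! (i - 1))\<^sup>2)"
proof -
  let ?X = "rearrange m1 m2 n1 n2 X"
  let ?v = "min (m1 * n1) (m2 * n2)"
  \<comment> \<open>\<open>p\<close> encodes the block that contains the entry (x, y) and
    \<open>q\<close> its place in that block; together they invert
    \<open>rearrange_index\<close>.\<close>
  define p where "p x y = y div n2 * m1 + x div m2" for x y
  define q where "q x y = y mod n2 * m2 + x mod m2" for x y
  have split: "x div m2 < m1" "x mod m2 < m2" "y div n2 < n1" "y mod n2 < n2"
    if "x < m1 * m2" "y < n1 * n2" for x y
    using that by (auto simp: less_mult_imp_div_less intro!: mod_less_divisor Nat.gr0I)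
  have pq: "p x y < m1 * n1" "q x y < m2 * n2" if "x < m1 * m2" "y < n1 * n2" for x y
    using mult_add_less[OF split(3,1)[OF that]] mult_add_less[OF split(4,2)[OF that]]
    by (simp_all add: p_def q_def mult.commute)
  have Xpq: "X $$ (x, y) = ?X $$ (p x y, q x y)" if "x < m1 * m2" "y < n1 * n2" for x y
    using rearrange_index[OF split(1,3,2,4)[OF that], of X] by (simp add: p_def q_def)
  define R where "R = mat (m1 * n1) (m2 * n2) (\<lambda>(i, j). Re (?X $$ (i, j)))"
  have R: "R \<in> carrier_mat (m1 * n1) (m2 * n2)" by (simp add: R_def)
  have X_real: "?X $$ (i, j) \<in> \<real>" if ij: "i < m1 * n1" "j < m2 * n2" for i j
  proof -
    have "0 < m1" "0 < m2" using ij by (auto intro: Nat.gr0I)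
    then have d: "i mod m1 < m1" "i div m1 < n1" "j mod m2 < m2" "j div m2 < n2"
      using ij by (auto simp: less_mult_imp_div_less mult.commute)
    then show ?thesis
      using rearrange_index[OF d, of X] X elements_mat_subset[OF X(1), of "\<real>"]
        mult_add_less[OF d(1,3)] mult_add_less[OF d(2,4)] by simp
  qed
  have RX: "map_mat complex_of_real R = ?X"
    using rearrange_carrier[of m1 m2 n1 n2 X] X_real by (intro eq_matI) (auto simp: R_def)
  obtain us ws sig where us: "orthonormal (m1 * n1) us" "length us = m1 * n1"
    and ws: "orthonormal (m2 * n2) ws" "length ws = m2 * n2" and sig: "length sig = m2 * n2"
    and sv: "singular_values ?X = take ?v sig"
    and svd: "\<And>a c. a < m1 * n1 \<Longrightarrow> c < m2 * n2 \<Longrightarrow> R $$ (a, c) = (\<Sum>i<?v. us ! i $ a * sig ! i * ws ! i $ c)"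
    by (rule real_svd[OF R, unfolded RX]) blast
  define t where "t i x y = (if i < ?v then us ! i $ x * sig ! i * ws ! i $ y else 0)" for i x y
  \<comment> \<open>For large i the vector \<open>us ! i\<close> is unspecified, but the entries of
    \<open>B i\<close> are still real, and \<open>C i\<close> is then zero, so the product is
    unaffected.\<close>
  define B where "B i = mat m1 n1 (\<lambda>(a, b). complex_of_real (us ! i $ (b * m1 + a)))" for i
  define C where "C i = mat m2 n2 (\<lambda>(r, c). complex_of_real (if i < ?v then sig ! i * ws ! i $ (c * m2 + r) else 0))" for i
  have BC: "B i \<in> carrier_mat m1 n1" "elements_mat (B i) \<subseteq> \<real>"
    "C i \<in> carrier_mat m2 n2" "elements_mat (C i) \<subseteq> \<real>" for i
    by (auto simp: B_def C_def elements_mat_def)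
  have kBC: "kron (B i) (C i) $$ (x, y) = complex_of_real (t i (p x y) (q x y))"
    if xy: "x < m1 * m2" "y < n1 * n2" for i x y
    using split[OF xy] unfolding kron_index[OF BC(1,3) xy] by (simp add: B_def C_def t_def p_def q_def)
  \<comment> \<open>Summands are numbered from 1, singular vectors from 0. The value at i = 0
    repeats the one at 1 and lies outside the sum.\<close>
  have "\<forall>i. \<exists>U S V. real_orthogonal m1 U \<and> real_orthogonal n1 V \<and>
      block_diagonal m1 m2 n1 n2 S \<and> elements_mat S \<subseteq> \<real> \<and>
      kron U (1\<^sub>m m2) * S * kron (transpose_mat V) (1\<^sub>m n2) = kron (B (i - 1)) (C (i - 1))"
    by (intro allI, rule kron_factorization[OF BC]) blast
  then obtain U S V where USV: "\<And>i. real_orthogonal m1 (U i)" "\<And>i. real_orthogonal n1 (V i)"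
      "\<And>i. block_diagonal m1 m2 n1 n2 (S i)" "\<And>i. elements_mat (S i) \<subseteq> \<real>"
    and prod: "\<And>i. kron (U i) (1\<^sub>m m2) * S i * kron (transpose_mat (V i)) (1\<^sub>m n2) = kron (B (i - 1)) (C (i - 1))"
    by metis
  define z where "z a b = (\<Sum>i=k..<?v. us ! i $ a * sig ! i * ws ! i $ b)" for a b
  define Z where "Z = mat (m1 * m2) (n1 * n2) (\<lambda>(x, y). complex_of_real (z (p x y) (q x y)))"
  have "X $$ (x, y) = (\<Sum>i=1..k. (kron (U i) (1\<^sub>m m2) * S i * kron (transpose_mat (V i)) (1\<^sub>m n2)) $$ (x, y))
      + Z $$ (x, y)" if xy: "x < m1 * m2" "y < n1 * n2" for x y
  proof -
    have "R $$ (p x y, q x y) = (\<Sum>i<k. t i (p x y) (q x y)) + z (p x y) (q x y)"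
      unfolding svd[OF pq[OF xy]] t_def z_def by (rule sum_lessThan_split)
    also have "(\<Sum>i<k. t i (p x y) (q x y)) = (\<Sum>i=1..k. t (i - 1) (p x y) (q x y))"
      by (rule sum.reindex_bij_witness[of _ "\<lambda>i. i - 1" Suc]) auto
    finally have "complex_of_real (R $$ (p x y, q x y))
        = (\<Sum>i=1..k. complex_of_real (t (i - 1) (p x y) (q x y))) + Z $$ (x, y)"
      using xy by (simp add: Z_def)
    moreover have "complex_of_real (R $$ (p x y, q x y)) = X $$ (x, y)"
      using Xpq[OF xy] RX R pq[OF xy] by (metis carrier_matD index_map_mat(1))
    ultimately show ?thesis by (simp add: prod kBC[OF xy])
  qed
  moreover have "(\<Sum>x<m1 * m2. \<Sum>y<n1 * n2. (cmod (Z $$ (x, y)))\<^sup>2)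
       = (\<Sum>i=k+1..?v. (singular_values ?X ! (i - 1))\<^sup>2)"
  proof -
    have "(\<Sum>x<m1 * m2. \<Sum>y<n1 * n2. (cmod (Z $$ (x, y)))\<^sup>2)
        = (\<Sum>x<m1 * m2. \<Sum>y<n1 * n2. (z (p x y) (q x y))\<^sup>2)"
      by (simp add: Z_def)
    \<comment> \<open>Both indices are split into block index and offset; exchanging the order to b,
      a, c, r makes them run through the rows and columns of the rearranged matrix, without an
      explicit bijection of index pairs.\<close>
    also have "\<dots> = (\<Sum>a<m1. \<Sum>r<m2. \<Sum>b<n1. \<Sum>c<n2. (z (b * m1 + a) (c * m2 + r))\<^sup>2)"
      by (simp add: sum_lessThan_mult p_def q_def)
    also have "\<dots> = (\<Sum>a<m1. \<Sum>b<n1. \<Sum>r<m2. \<Sum>c<n2. (z (b * m1 + a) (c * m2 + r))\<^sup>2)"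
      by (rule sum.cong[OF refl], rule sum.swap)
    also have "\<dots> = (\<Sum>b<n1. \<Sum>a<m1. \<Sum>r<m2. \<Sum>c<n2. (z (b * m1 + a) (c * m2 + r))\<^sup>2)"
      by (rule sum.swap)
    also have "\<dots> = (\<Sum>b<n1. \<Sum>a<m1. \<Sum>c<n2. \<Sum>r<m2. (z (b * m1 + a) (c * m2 + r))\<^sup>2)"
      by (rule sum.cong[OF refl], rule sum.cong[OF refl], rule sum.swap)
    also have "\<dots> = (\<Sum>a<m1 * n1. \<Sum>b<m2 * n2. (z a b)\<^sup>2)"
      by (simp add: sum_lessThan_mult mult.commute[of m1] mult.commute[of m2])
    also have "\<dots> = (\<Sum>i=k..<?v. (sig ! i)\<^sup>2)"
      unfolding z_def using us ws by (intro orthonormal_sum_norm) auto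
    also have "\<dots> = (\<Sum>i=k+1..?v. (sig ! (i - 1))\<^sup>2)"
      by (rule sum.reindex_bij_witness[of _ "\<lambda>i. i - 1" Suc]) auto
    also have "\<dots> = (\<Sum>i=k+1..?v. (singular_values ?X ! (i - 1))\<^sup>2)"
      by (intro sum.cong refl) (auto simp: sv less_eq_Suc_le)
    finally show ?thesis .
  qed
  moreover have "Z \<in> carrier_mat (m1 * m2) (n1 * n2)" "elements_mat Z \<subseteq> \<real>"
    by (auto simp: Z_def elements_mat_def)
  ultimately show thesis using USV by (intro that[of U V S Z])
qed

theorem theorem4p3:
  fixes m1 m2 n1 n2 l k :: nat and M :: "complex mat" and \<rho> :: real and A :: tensor
  assumes "0 < m1" "0 < m2" "0 < n1" "0 < n2" "0 < l" "0 < k"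
    and "M \<in> carrier_mat l l" and "invertible_mat M"
    and "\<And>p q X. X \<in> real_tensors p q l \<Longrightarrow> mode3 M X \<in> real_tensors p q l"
    and "0 < \<rho>"
    and "mat_adjoint M * M = complex_of_real \<rho> \<cdot>\<^sub>m 1\<^sub>m l"
    and "M * mat_adjoint M = complex_of_real \<rho> \<cdot>\<^sub>m 1\<^sub>m l"
    and "mat_inv M = complex_of_real (1 / \<rho>) \<cdot>\<^sub>m mat_adjoint M"
    and "A \<in> real_tensors (m1 * m2) (n1 * n2) l"
  shows "\<exists>(U :: nat \<Rightarrow> tensor) (S :: nat \<Rightarrow> tensor) (V :: nat \<Rightarrow> tensor) (E :: tensor).
    (\<forall>i\<in>{1..k}. t_orthogonal M m1 l (U i) \<and> t_orthogonal M n1 l (V i) \<and>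
       S i \<in> real_tensors (m1 * m2) (n1 * n2) l \<and>
       (\<forall>j<l. block_diagonal m1 m2 n1 n2 (S i ! j))) \<and>
    E \<in> real_tensors (m1 * m2) (n1 * n2) l \<and>
    A = tensor_add
          (tensor_sum (m1 * m2) (n1 * n2) l
             (\<lambda>i. semi_tensor_prod M (semi_tensor_prod M (U i) (S i)) (t_transpose M (V i))) {1..k})
          E \<and>
    (tensor_norm E)\<^sup>2 =
      1 / \<rho> * (\<Sum>j<l. \<Sum>i = k + 1..min (m1 * n1) (m2 * n2).
                 (singular_values (rearrange m1 m2 n1 n2 (mode3 M A ! j)) ! (i - 1))\<^sup>2)"
proof -
  note pos = assms(1-5) and M = assms(7,8) and rho = assms(10) and A = assms(14)
  note l = \<open>0 < l\<close>
  let ?N = "mat_inv M"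
  have A': "A \<in> tensors (m1 * m2) (n1 * n2) l" using A by (simp add: real_tensors_alt)
  have Mreal: "elements_mat M \<subseteq> \<real>" by (rule mode3_entries_real[OF M(1) assms(9)])
  have N: "?N \<in> carrier_mat l l" by (rule mat_inv(1)[OF M])
  \<comment> \<open>The inverse is a real multiple of the adjoint, whose entries are conjugates of
    real numbers.\<close>
  have Nreal: "elements_mat ?N \<subseteq> \<real>"
  proof -
    have "?N $$ (i, j) \<in> \<real>" if ij: "i < l" "j < l" for i j
    proof -
      have "M $$ (j, i) \<in> \<real>" using Mreal ij elements_mat_subset[OF M(1), of "\<real>"] by simp
      then show ?thesis
        using ij M(1) unfolding assms(13) by (auto simp: mat_adjoint_def mat_of_rows_def Reals_cnj_iff)
    qed
    then show ?thesis using elements_mat_subset[OF N, of "\<real>"] by simp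
  qed
  have MA: "mode3 M A \<in> real_tensors (m1 * m2) (n1 * n2) l" by (rule assms(9)[OF A])
  define P where "P j U S V Z \<longleftrightarrow> (\<forall>i. real_orthogonal m1 (U i)) \<and> (\<forall>i. real_orthogonal n1 (V i)) \<and>
      (\<forall>i. block_diagonal m1 m2 n1 n2 (S i)) \<and> (\<forall>i. elements_mat (S i) \<subseteq> \<real>) \<and>
      Z \<in> carrier_mat (m1 * m2) (n1 * n2) \<and> elements_mat Z \<subseteq> \<real> \<and>
      (\<forall>x<m1 * m2. \<forall>y<n1 * n2. mode3 M A ! j $$ (x, y)
        = (\<Sum>i=1..k. (kron (U i) (1\<^sub>m m2) * S i * kron (transpose_mat (V i)) (1\<^sub>m n2)) $$ (x, y)) + Z $$ (x, y)) \<and>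
      (\<Sum>x<m1 * m2. \<Sum>y<n1 * n2. (cmod (Z $$ (x, y)))\<^sup>2)
       = (\<Sum>i=k+1..min (m1 * n1) (m2 * n2). (singular_values (rearrange m1 m2 n1 n2 (mode3 M A ! j)) ! (i - 1))\<^sup>2)"
    for j U S V Z
  \<comment> \<open>The guard \<open>j < l\<close> inside the existential makes it true for every j,
    so that factors can be chosen as functions of the slice.\<close>
  have "\<forall>j. \<exists>U S V Z. j < l \<longrightarrow> P j U S V Z"
  proof (intro allI)
    fix j
    show "\<exists>U S V Z. j < l \<longrightarrow> P j U S V Z"
    proof (cases "j < l")
      case True
      then have "mode3 M A ! j \<in> carrier_mat (m1 * m2) (n1 * n2)" "elements_mat (mode3 M A ! j) \<subseteq> \<real>"
        using MA tensors_nth unfolding real_tensors_alt by auto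
      then show ?thesis by (rule slice_factorization[where k = k]) (unfold P_def, blast)
    qed simp
  qed
  then obtain U S V Z where P: "\<And>j. j < l \<Longrightarrow> P j (U j) (S j) (V j) (Z j)" by metis
  have slice: "real_orthogonal m1 (U j i)" "real_orthogonal n1 (V j i)"
      "block_diagonal m1 m2 n1 n2 (S j i)" "elements_mat (S j i) \<subseteq> \<real>" if "j < l" for i j
    using P[OF that] by (simp_all only: P_def)
  have Z: "Z j \<in> carrier_mat (m1 * m2) (n1 * n2)" "elements_mat (Z j) \<subseteq> \<real>" if "j < l" for j
    using P[OF that] by (simp_all only: P_def)
  have dec: "mode3 M A ! j $$ (x, y)
        = (\<Sum>i=1..k. (kron (U j i) (1\<^sub>m m2) * S j i * kron (transpose_mat (V j i)) (1\<^sub>m n2)) $$ (x, y)) + Z j $$ (x, y)"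
    if "j < l" "x < m1 * m2" "y < n1 * n2" for j x y
    using P[OF that(1)] that(2,3) unfolding P_def by blast
  have err: "(\<Sum>x<m1 * m2. \<Sum>y<n1 * n2. (cmod (Z j $$ (x, y)))\<^sup>2)
       = (\<Sum>i=k+1..min (m1 * n1) (m2 * n2). (singular_values (rearrange m1 m2 n1 n2 (mode3 M A ! j)) ! (i - 1))\<^sup>2)"
    if "j < l" for j
    using P[OF that] unfolding P_def by blast
  \<comment> \<open>The tensor whose transform has the prescribed slices \<open>C j\<close>.\<close>
  define lift where "lift C = mode3 ?N (map C [0..<l])" for C :: "nat \<Rightarrow> complex mat"
  have lift: "lift C \<in> real_tensors p q l"
    if "\<And>j. j < l \<Longrightarrow> C j \<in> carrier_mat p q \<and> elements_mat (C j) \<subseteq> \<real>" for C p q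
    unfolding lift_def using that
    by (intro mode3_real_tensors[OF _ l N Nreal]) (auto simp: real_tensors_def tensors_def)
  have mode3_lift: "mode3 M (lift C) ! j = C j"
    if "\<And>j. j < l \<Longrightarrow> C j \<in> carrier_mat p q \<and> elements_mat (C j) \<subseteq> \<real>" "j < l" for C p q j
    unfolding lift_def using that by (subst mode3_inverse[OF M l]) auto
  \<comment> \<open>The choice above is indexed by slice and then summand; here the slices of one
    summand are gathered into one tensor.\<close>
  define Ut where "Ut i = lift (\<lambda>j. U j i)" for i
  define St where "St i = lift (\<lambda>j. S j i)" for i
  define Vt where "Vt i = lift (\<lambda>j. V j i)" for i
  define E where "E = lift Z"
  have Uc: "U j i \<in> carrier_mat m1 m1 \<and> elements_mat (U j i) \<subseteq> \<real>" if "j < l" for i j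
    using slice(1)[OF that] by (simp add: real_orthogonal_def)
  have Vc: "V j i \<in> carrier_mat n1 n1 \<and> elements_mat (V j i) \<subseteq> \<real>" if "j < l" for i j
    using slice(2)[OF that] by (simp add: real_orthogonal_def)
  have Sc: "S j i \<in> carrier_mat (m1 * m2) (n1 * n2) \<and> elements_mat (S j i) \<subseteq> \<real>" if "j < l" for i j
    using slice(3,4)[OF that] by (simp add: block_diagonal_def)
  have Zc: "Z j \<in> carrier_mat (m1 * m2) (n1 * n2) \<and> elements_mat (Z j) \<subseteq> \<real>" if "j < l" for j
    using Z[OF that] by simp
  have Ut: "Ut i \<in> real_tensors m1 m1 l" "\<And>j. j < l \<Longrightarrow> mode3 M (Ut i) ! j = U j i" for i
    using lift[of "\<lambda>j. U j i", OF Uc] mode3_lift[of "\<lambda>j. U j i", OF Uc] by (simp_all add: Ut_def)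
  have Vt: "Vt i \<in> real_tensors n1 n1 l" "\<And>j. j < l \<Longrightarrow> mode3 M (Vt i) ! j = V j i" for i
    using lift[of "\<lambda>j. V j i", OF Vc] mode3_lift[of "\<lambda>j. V j i", OF Vc] by (simp_all add: Vt_def)
  have St: "St i \<in> real_tensors (m1 * m2) (n1 * n2) l" "\<And>j. j < l \<Longrightarrow> mode3 M (St i) ! j = S j i" for i
    using lift[of "\<lambda>j. S j i", OF Sc] mode3_lift[of "\<lambda>j. S j i", OF Sc] by (simp_all add: St_def)
  have E: "E \<in> real_tensors (m1 * m2) (n1 * n2) l" "\<And>j. j < l \<Longrightarrow> mode3 M E ! j = Z j"
    using lift[of Z, OF Zc] mode3_lift[of Z, OF Zc] by (simp_all add: E_def)
  have E': "E \<in> tensors (m1 * m2) (n1 * n2) l" using E(1) by (simp add: real_tensors_alt)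
  have orth: "t_orthogonal M m1 l (Ut i)" "t_orthogonal M n1 l (Vt i)" for i
    using Ut Vt slice(1,2) by (auto intro!: t_orthogonal_transform[OF M l])
  have blk: "block_diagonal m1 m2 n1 n2 (St i ! j)" if "j < l" for i j
    unfolding St_def lift_def
    by (rule mode3_block_diagonal[OF _ l N _ that]) (use Sc slice(3) in \<open>auto simp: tensors_def\<close>)
  let ?T = "\<lambda>i. semi_tensor_prod M (semi_tensor_prod M (Ut i) (St i)) (t_transpose M (Vt i))"
  have mem: "Ut i \<in> tensors m1 m1 l" "St i \<in> tensors (m1 * m2) (n1 * n2) l" "Vt i \<in> tensors n1 n1 l" for i
    using Ut(1) St(1) Vt(1) by (auto simp: real_tensors_alt)
  note T = semi_tensor_prod_factors_in_tensors[OF M l pos(1-4) mem]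
  have "A = tensor_add (tensor_sum (m1 * m2) (n1 * n2) l ?T {1..k}) E" (is "_ = ?R")
  \<comment> \<open>The equation is compared after the transform, where each semi-tensor product has
    become the matrix product occurring in \<open>dec\<close>.\<close>
  proof (rule mode3_inject[OF M l A'])
    show R: "?R \<in> tensors (m1 * m2) (n1 * n2) l" by (rule tensor_sum_add_in_tensors[OF E'])
    fix j assume j: "j < l"
    show "mode3 M A ! j = mode3 M ?R ! j"
    proof (rule eq_matI)
      have c: "mode3 M A ! j \<in> carrier_mat (m1 * m2) (n1 * n2)" "mode3 M ?R ! j \<in> carrier_mat (m1 * m2) (n1 * n2)"
        using j M(1) mode3_in_tensors[OF A' l, of M] mode3_in_tensors[OF R l, of M] by (auto intro: tensors_nth)
      then show "dim_row (mode3 M A ! j) = dim_row (mode3 M ?R ! j)"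
        "dim_col (mode3 M A ! j) = dim_col (mode3 M ?R ! j)" by auto
      fix x y assume "x < dim_row (mode3 M ?R ! j)" "y < dim_col (mode3 M ?R ! j)"
      then have xy: "x < m1 * m2" "y < n1 * n2" using c by auto
      show "mode3 M A ! j $$ (x, y) = mode3 M ?R ! j $$ (x, y)"
        unfolding mode3_tensor_sum_add[OF l M(1) T E' j xy] dec[OF j xy] semi_tensor_prod_factors[OF M l pos(1-4) mem j]
          Ut(2)[OF j] St(2)[OF j] Vt(2)[OF j] E(2)[OF j] ..
    qed
  qed
  moreover have "(tensor_norm E)\<^sup>2 = 1 / \<rho> * (\<Sum>j<l. \<Sum>i = k + 1..min (m1 * n1) (m2 * n2).
                 (singular_values (rearrange m1 m2 n1 n2 (mode3 M A ! j)) ! (i - 1))\<^sup>2)"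
    unfolding tensor_norm_transform[OF l M(1) rho assms(11) E'] using E(2) err by simp
  ultimately show ?thesis using orth St(1) blk E(1) by (intro exI[of _ Ut] exI[of _ St] exI[of _ Vt] exI[of _ E]) blast
qed

end
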